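(* There is an algorithm that, given an $m\times n$ Boolean matrix $\mathbf{UPA}$, an $m\times n$ label matrix $\mathbf{F}$ with entries in $\{\top,\bot\}$, and upper bounds $\bar r\ge 1$ and $\bar k\ge 0$ (integers), constructs the Pareto front of BO-GNRM in time $\mathcal{O}^*(2^{\mathcal{O}(\bar r2^{\bar r}+\bar r\bar k)})$. Thus, BO-GNRM is fixed-parameter tractable with parameter $\bar r+\bar k$.
   Context: A Boolean matrix is a matrix with entries in $\{0,1\}$. For Boolean matrices $\mathbf{A}$ ($m\times r$) and $\mathbf{B}$ ($r\times n$), the Boolean product $\mathbf{C}=\mathbf{A}\wedge\mathbf{B}$ is the $m\times n$ Boolean matrix with $c_{ij}=\bigvee_{\ell=1}^{r}(a_{i\ell}\wedge b_{\ell j})$. A label matrix is a matrix $\mathbf{F}$ with entries $f_{ij}\in\{\top,\bot\}$. For $m\times n$ Boolean matrices $\mathbf{A},\mathbf{B}$ and an $m\times n$ label matrix $\mathbf{F}$, define $\mathsf{sd}_{\mathbf{F}}(a_{ij},b_{ij})=\infty$ if $f_{ij}=\bot$ and $a_{ij}\neq b_{ij}$, and $\mathsf{sd}_{\mathbf{F}}(a_{ij},b_{ij})=|a_{ij}-b_{ij}|$ otherwise; and $\mathsf{sd}_{\mathbf{F}}(\mathbf{A},\mathbf{B})=\sum_{i=1}^m\sum_{j=1}^n \mathsf{sd}_{\mathbf{F}}(a_{ij},b_{ij})$. BO-GNRM (bi-objective Generalized Noise Role Mining): the input is $\mathbf{UPA}$, $\mathbf{F}$, $\bar r$, $\bar k$.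 A pair $(r',k')$ of integers with $r'\ge1$, $k'\ge0$ is a feasible solution if there exist an $m\times r'$ Boolean matrix $\mathbf{UA}$ and an $r'\times n$ Boolean matrix $\mathbf{PA}$ with $\mathsf{sd}_{\mathbf{F}}(\mathbf{UPA},\mathbf{UA}\wedge\mathbf{PA})\le k'$. A feasible solution $(r',k')$ is Pareto optimal if there is no feasible solution $(r'',k'')$ such that either $r''<r'$ and $k''\le k'$, or $r''\le r'$ and $k''<k'$. Both $r$ and $k$ are to be minimized subject to $r\le\bar r$ and $k\le\bar k$; the goal is to compute the Pareto front, i.e. the set of all Pareto optimal solutions $(r,k)$ with $r\le\bar r$ and $k\le\bar k$. The notation $\mathcal{O}^*(g)$ means $\mathcal{O}(g\cdot |I|^c)$, where $|I|$ is the size of the input and $c$ is an absolute constant. A problem is fixed-parameter tractable with parameter $\kappa$ if it can be solved in time $\mathcal{O}(f(\kappa)|I|^c)$ for some computable function $f$ and absolute constant $c$. *)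

theory Defs
  imports
    "Jordan_Normal_Form.Matrix"
    "HOL-Library.Extended_Nat"
    "HOL-Library.Landau_Symbols"
    "HOL-Library.Log_Nat"
begin

section \<open>Model of computation\<close>

text \<open>
  Algorithms are while programs for a random access machine with finitely many registers and
  finitely many arrays (a program mentions only finitely many indices), all holding natural
  numbers.  Subtraction is truncated.  Since there is no multiplication, a computation of
  \<open>t\<close> steps only lengthens its numbers by \<open>O(t)\<close> bits, so the unit-cost
  measure is polynomially related to Turing machine time.
\<close>

datatype exp =
    Const nat
  | Reg nat
  | Elem nat exp
  | Plus exp exp
  | Minus exp exp

datatype com =
    Skip
  | Assign nat exp
  | Store nat exp exp
  | Seq com com
  | Cond exp com com
  | While exp com

type_synonym state = "(nat \<Rightarrow> nat) \<times> (nat \<Rightarrow> nat \<Rightarrow> nat)"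

fun eval :: "exp \<Rightarrow> state \<Rightarrow> nat" where
  "eval (Const c) s = c"
| "eval (Reg x) s = fst s x"
| "eval (Elem a e) s = snd s a (eval e s)"
| "eval (Plus e1 e2) s = eval e1 s + eval e2 s"
| "eval (Minus e1 e2) s = eval e1 s - eval e2 s"

fun cost :: "exp \<Rightarrow> nat" where
  "cost (Const c) = 1"
| "cost (Reg x) = 1"
| "cost (Elem a e) = 1 + cost e"
| "cost (Plus e1 e2) = 1 + cost e1 + cost e2"
| "cost (Minus e1 e2) = 1 + cost e1 + cost e2"

text \<open>\<open>exec c s t s'\<close>: started in \<open>s\<close>, \<open>c\<close> halts in \<open>s'\<close> after time
  \<open>t\<close>.  A test succeeds iff its value is nonzero.\<close>

inductive exec :: "com \<Rightarrow> state \<Rightarrow> nat \<Rightarrow> state \<Rightarrow> bool" where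
  Skip: "exec Skip s 1 s"
| Assign: "exec (Assign x e) (R, A) (1 + cost e) (R(x := eval e (R, A)), A)"
| Store: "exec (Store a i e) (R, A) (1 + cost i + cost e)
    (R, A(a := (A a)(eval i (R, A) := eval e (R, A))))"
| Seq: "exec c1 s t1 s' \<Longrightarrow> exec c2 s' t2 s'' \<Longrightarrow> exec (Seq c1 c2) s (t1 + t2) s''"
| CondTrue: "eval b s \<noteq> 0 \<Longrightarrow> exec c1 s t s' \<Longrightarrow> exec (Cond b c1 c2) s (1 + cost b + t) s'"
| CondFalse: "eval b s = 0 \<Longrightarrow> exec c2 s t s' \<Longrightarrow> exec (Cond b c1 c2) s (1 + cost b + t) s'"
| WhileFalse: "eval b s = 0 \<Longrightarrow> exec (While b c) s (1 + cost b) s"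
| WhileTrue: "eval b s \<noteq> 0 \<Longrightarrow> exec c s t1 s' \<Longrightarrow> exec (While b c) s' t2 s'' \<Longrightarrow>
    exec (While b c) s (1 + cost b + t1 + t2) s''"

lemma exec_deterministic:
  assumes "exec c s t s'" and "exec c s u s''"
  shows "t = u \<and> s' = s''"
  using assms
proof (induction arbitrary: u s'' rule: exec.induct)
  case (Seq c1 s t1 s' c2 t2 s3)
  from Seq.prems show ?case by cases (use Seq.IH in blast)
next
  case (WhileTrue b s c t1 s' t2 s3)
  from WhileTrue.prems show ?case by cases (use WhileTrue.IH WhileTrue.hyps in blast)+
next
  case (CondTrue b s c1 t s' c2)
  from CondTrue.prems show ?case by cases (use CondTrue.IH CondTrue.hyps in blast)+
next
  case (CondFalse b s c2 t s' c1)
  from CondFalse.prems show ?case by cases (use CondFalse.IH CondFalse.hyps in blast)+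
next
  case (WhileFalse b s c)
  from WhileFalse.prems show ?case by cases (use WhileFalse.hyps in blast)+
qed (auto elim: exec.cases)

text \<open>A list of words is passed in and out in array \<open>0\<close>, its length in register \<open>0\<close>.\<close>

definition input_state :: "nat list \<Rightarrow> state" where
  "input_state ws =
    ((\<lambda>_. 0)(0 := length ws),
     (\<lambda>_ _. 0)(0 := (\<lambda>i. if i < length ws then ws ! i else 0)))"

definition result :: "state \<Rightarrow> nat list" where
  "result s = map (snd s 0) [0..<fst s 0]"

definition computes :: "com \<Rightarrow> nat list \<Rightarrow> nat \<Rightarrow> nat list \<Rightarrow> bool" where
  "computes p ws t out \<longleftrightarrow> (\<exists>s. exec p (input_state ws) t s \<and> result s = out)"

definition computable :: "(nat \<Rightarrow> nat) \<Rightarrow> bool" where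
  "computable f \<longleftrightarrow> (\<exists>p. \<forall>n. \<exists>t. computes p [n] t [f n])"


section \<open>Search problems and running times\<close>

record 'i problem =
  instances :: "'i set"
  encode :: "'i \<Rightarrow> nat list"
  solution :: "'i \<Rightarrow> nat list \<Rightarrow> bool"

text \<open>The size of an input is its bit length, with one additional symbol terminating each word.\<close>

definition input_size :: "('i, 'm) problem_scheme \<Rightarrow> 'i \<Rightarrow> nat" where
  "input_size P x = (\<Sum>w\<leftarrow>encode P x. 1 + floorlog 2 w)"

definition solves_in_time ::
    "com \<Rightarrow> ('i, 'm) problem_scheme \<Rightarrow> ('i \<Rightarrow> real) \<Rightarrow> bool" where
  "solves_in_time p P T \<longleftrightarrow>
    (\<forall>x \<in> instances P. \<exists>t out. computes p (encode P x) t out \<and> solution P x out \<and> real t \<le> T x)"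

text \<open>With the filter \<open>principal (instances P)\<close> the Landau symbol means a bound that is
  uniform over all instances.\<close>

definition O_star :: "('i, 'm) problem_scheme \<Rightarrow> ('i \<Rightarrow> real) \<Rightarrow> ('i \<Rightarrow> real) set" where
  "O_star P g =
    {T. \<exists>c::nat. T \<in> O[principal (instances P)](\<lambda>x. g x * real (input_size P x) ^ c)}"

definition fixed_parameter_tractable ::
    "('i, 'm) problem_scheme \<Rightarrow> ('i \<Rightarrow> nat) \<Rightarrow> bool" where
  "fixed_parameter_tractable P \<kappa> \<longleftrightarrow>
    (\<exists>p T f. computable f \<and> T \<in> O_star P (\<lambda>x. real (f (\<kappa> x))) \<and> solves_in_time p P T)"


section \<open>Bi-objective Generalized Noise Role Mining\<close>

text \<open>Boolean matrices have type \<open>bool mat\<close>, with \<open>True\<close> for \<open>1\<close> and \<open>False\<close> for \<open>0\<close>.\<close>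

definition bool_prod :: "bool mat \<Rightarrow> bool mat \<Rightarrow> bool mat" where
  "bool_prod A B =
    mat (dim_row A) (dim_col B) (\<lambda>(i, j). \<exists>l < dim_col A. A $$ (i, l) \<and> B $$ (l, j))"

datatype label = LTop | LBot

definition sd_entry :: "label \<Rightarrow> bool \<Rightarrow> bool \<Rightarrow> enat" where
  "sd_entry f a b =
    (if f = LBot \<and> a \<noteq> b then \<infinity> else enat (nat \<bar>of_bool a - of_bool b\<bar>))"

definition sd :: "label mat \<Rightarrow> bool mat \<Rightarrow> bool mat \<Rightarrow> enat" where
  "sd F A B =
    (\<Sum>i < dim_row A. \<Sum>j < dim_col A. sd_entry (F $$ (i, j)) (A $$ (i, j)) (B $$ (i, j)))"

definition feasible :: "bool mat \<Rightarrow> label mat \<Rightarrow> nat \<Rightarrow> nat \<Rightarrow> bool" where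
  "feasible UPA F r k \<longleftrightarrow> r \<ge> 1 \<and>
    (\<exists>UA \<in> carrier_mat (dim_row UPA) r. \<exists>PA \<in> carrier_mat r (dim_col UPA).
      sd F UPA (bool_prod UA PA) \<le> enat k)"

definition pareto_optimal :: "bool mat \<Rightarrow> label mat \<Rightarrow> nat \<Rightarrow> nat \<Rightarrow> bool" where
  "pareto_optimal UPA F r k \<longleftrightarrow> feasible UPA F r k \<and>
    \<not> (\<exists>r' k'. feasible UPA F r' k' \<and> (r' < r \<and> k' \<le> k \<or> r' \<le> r \<and> k' < k))"

record gnrm_instance =
  UPA :: "bool mat"
  lab :: "label mat"
  rmax :: nat
  kmax :: nat

definition pareto_front :: "gnrm_instance \<Rightarrow> (nat \<times> nat) set" where
  "pareto_front I =
    {(r, k). pareto_optimal (UPA I) (lab I) r k \<and> r \<le> rmax I \<and> k \<le> kmax I}"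

definition row_major :: "'a mat \<Rightarrow> 'a list" where
  "row_major A = [A $$ (i, j). i \<leftarrow> [0..<dim_row A], j \<leftarrow> [0..<dim_col A]]"

text \<open>The front is output as the concatenation of its elements, without repetitions and in
  any order.\<close>

definition BO_GNRM :: "gnrm_instance problem" where
  "BO_GNRM = \<lparr>
    instances = {I. dim_row (lab I) = dim_row (UPA I) \<and> dim_col (lab I) = dim_col (UPA I) \<and>
      rmax I \<ge> 1},
    encode = (\<lambda>I. [dim_row (UPA I), dim_col (UPA I), rmax I, kmax I] @
      map of_bool (row_major (UPA I)) @
      map (\<lambda>f. of_bool (f = LTop)) (row_major (lab I))),
    solution = (\<lambda>I out. \<exists>ps. distinct ps \<and> set ps = pareto_front I \<and>
      out = concat (map (\<lambda>(r, k). [r, k]) ps))\<rparr>"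

end

theory Submission
  imports Defs
begin

text \<open>
  Fix the number \<open>r\<close> of roles.  Once \<open>PA\<close> is known, every row of \<open>UA\<close> can be chosen
  independently by trying all \<open>2 ^ r\<close> subsets of roles.  A product of cost at most \<open>k\<close> leaves
  at most \<open>k\<close> columns of \<open>UPA\<close> inexact, and the remaining columns fall into at most
  \<open>2 ^ r\<close> classes of equal columns.  If some column of a class is exact, then all columns of the
  class may use its column of \<open>PA\<close>.  Hence \<open>PA\<close> is determined by \<open>2 ^ r + k\<close> chunks of
  \<open>r + 1\<close> bits: a chunk holds a column of \<open>PA\<close> and a flag telling whether later equal
  columns of \<open>UPA\<close> copy it or read a new chunk.  Trying all bit strings yields the least cost for
  \<open>r\<close>, and the front consists of the values at which this minimum drops as \<open>r\<close> grows.
  No loop of the program makes more than \<open>M = 2 ^ O(r * 2 ^ r + r * k) * |I|\<close> iterations, and the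
  nesting depth of the loops is constant, so the running time is polynomial in \<open>M\<close>.
\<close>

section \<open>Verification of programs\<close>

notation Seq (infixr ";;" 60)

fun reads :: "exp \<Rightarrow> nat set" where
  "reads (Const c) = {}"
| "reads (Reg x) = {x}"
| "reads (Elem a e) = reads e"
| "reads (Plus e1 e2) = reads e1 \<union> reads e2"
| "reads (Minus e1 e2) = reads e1 \<union> reads e2"

fun reads_arr :: "exp \<Rightarrow> nat set" where
  "reads_arr (Const c) = {}"
| "reads_arr (Reg x) = {}"
| "reads_arr (Elem a e) = insert a (reads_arr e)"
| "reads_arr (Plus e1 e2) = reads_arr e1 \<union> reads_arr e2"
| "reads_arr (Minus e1 e2) = reads_arr e1 \<union> reads_arr e2"

fun writes :: "com \<Rightarrow> nat set" where
  "writes Skip = {}"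
| "writes (Assign x e) = {x}"
| "writes (Store a i e) = {}"
| "writes (c1 ;; c2) = writes c1 \<union> writes c2"
| "writes (Cond b c1 c2) = writes c1 \<union> writes c2"
| "writes (While b c) = writes c"

fun writes_arr :: "com \<Rightarrow> nat set" where
  "writes_arr Skip = {}"
| "writes_arr (Assign x e) = {}"
| "writes_arr (Store a i e) = {a}"
| "writes_arr (c1 ;; c2) = writes_arr c1 \<union> writes_arr c2"
| "writes_arr (Cond b c1 c2) = writes_arr c1 \<union> writes_arr c2"
| "writes_arr (While b c) = writes_arr c"

definition same :: "nat set \<Rightarrow> nat set \<Rightarrow> state \<Rightarrow> state \<Rightarrow> bool" where
  "same X Y s s' \<longleftrightarrow>
    (\<forall>x. x \<notin> X \<longrightarrow> fst s' x = fst s x) \<and> (\<forall>a. a \<notin> Y \<longrightarrow> snd s' a = snd s a)"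

lemma same_reg: "same X Y s s' \<Longrightarrow> x \<notin> X \<Longrightarrow> fst s' x = fst s x"
  and same_arr: "same X Y s s' \<Longrightarrow> a \<notin> Y \<Longrightarrow> snd s' a = snd s a"
  by (simp_all add: same_def)

lemma exec_same: "exec c s t s' \<Longrightarrow> same (writes c) (writes_arr c) s s'"
  by (induction rule: exec.induct) (auto simp: same_def)

lemma eval_same:
  "same X Y s s' \<Longrightarrow> reads e \<inter> X = {} \<Longrightarrow> reads_arr e \<inter> Y = {} \<Longrightarrow> eval e s' = eval e s"
  by (induction e) (auto simp: same_def Int_Un_distrib2)

text \<open>The time of \<open>c\<close> when none of its loops makes more than \<open>M\<close> iterations.\<close>

fun time_bound :: "nat \<Rightarrow> com \<Rightarrow> nat" where
  "time_bound M Skip = 1"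
| "time_bound M (Assign x e) = 1 + cost e"
| "time_bound M (Store a i e) = 1 + cost i + cost e"
| "time_bound M (c1 ;; c2) = time_bound M c1 + time_bound M c2"
| "time_bound M (Cond b c1 c2) = 1 + cost b + time_bound M c1 + time_bound M c2"
| "time_bound M (While b c) = (M + 1) * (1 + cost b + time_bound M c)"

text \<open>Each \<open>While\<close> contributes a factor M + 1, so the degree depends on the
  syntax of the program alone. Sequences and conditionals add the degrees, so that both terms fit
  under one power.\<close>

lemma time_bound_polynomial: "\<exists>C d. \<forall>M. time_bound M c \<le> C * (M + 1) ^ d"
proof (induction c)
  case (Seq c1 c2)
  then obtain C1 d1 C2 d2 where
    b: "\<And>M. time_bound M c1 \<le> C1 * (M + 1) ^ d1" "\<And>M. time_bound M c2 \<le> C2 * (M + 1) ^ d2"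
    by blast
  have "time_bound M (c1 ;; c2) \<le> (C1 + C2) * (M + 1) ^ (d1 + d2)" for M
  proof -
    have "C1 * (M + 1) ^ d1 \<le> C1 * (M + 1) ^ (d1 + d2)"
      "C2 * (M + 1) ^ d2 \<le> C2 * (M + 1) ^ (d1 + d2)"
      by (intro mult_left_mono power_increasing; simp)+
    with b[of M] show ?thesis unfolding time_bound.simps distrib_right by linarith
  qed
  then show ?case by blast
next
  case (Cond e c1 c2)
  then obtain C1 d1 C2 d2 where
    b: "\<And>M. time_bound M c1 \<le> C1 * (M + 1) ^ d1" "\<And>M. time_bound M c2 \<le> C2 * (M + 1) ^ d2"
    by blast
  have "time_bound M (Cond e c1 c2) \<le> (1 + cost e + C1 + C2) * (M + 1) ^ (d1 + d2)" for M
  proof -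
    have "C1 * (M + 1) ^ d1 \<le> C1 * (M + 1) ^ (d1 + d2)"
      "C2 * (M + 1) ^ d2 \<le> C2 * (M + 1) ^ (d1 + d2)"
      "(1 + cost e) * 1 \<le> (1 + cost e) * (M + 1) ^ (d1 + d2)"
      by (intro mult_left_mono power_increasing; simp)+
    with b[of M] show ?thesis unfolding time_bound.simps distrib_right by linarith
  qed
  then show ?case by blast
next
  case (While e c)
  then obtain C d where b: "\<And>M. time_bound M c \<le> C * (M + 1) ^ d" by blast
  have "time_bound M (While e c) \<le> (1 + cost e + C) * (M + 1) ^ (Suc d)" for M
  proof -
    have "(1 + cost e) * 1 \<le> (1 + cost e) * (M + 1) ^ d"
      by (intro mult_left_mono) auto
    with b[of M] have "1 + cost e + time_bound M c \<le> (1 + cost e + C) * (M + 1) ^ d"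
      unfolding distrib_right by linarith
    then have "(M + 1) * (1 + cost e + time_bound M c)
        \<le> (M + 1) * ((1 + cost e + C) * (M + 1) ^ d)"
      by (rule mult_left_mono) simp
    also have "\<dots> = (1 + cost e + C) * (M + 1) ^ (Suc d)" by (simp only: power_Suc ac_simps)
    finally show ?thesis by (simp only: time_bound.simps)
  qed
  then show ?case by blast
next
  case Skip
  show ?case by (intro exI[of _ 1] exI[of _ 0]) simp
next
  case (Assign x e)
  show ?case by (intro exI[of _ "1 + cost e"] exI[of _ 0]) simp
next
  case (Store a i e)
  show ?case by (intro exI[of _ "1 + cost i + cost e"] exI[of _ 0]) simp
qed

text \<open>Total correctness and the time bound in one predicate: a derivation by the rules below
  establishes both at once, without a separate running time analysis.\<close>

definition wp :: "nat \<Rightarrow> com \<Rightarrow> (state \<Rightarrow> bool) \<Rightarrow> state \<Rightarrow> bool" where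
  "wp M c Q s \<longleftrightarrow> (\<exists>t s'. exec c s t s' \<and> t \<le> time_bound M c \<and> Q s')"

text \<open>What \<open>c\<close> leaves untouched is read off its syntax, so the specification of a
  routine need only describe what it computes.\<close>

lemma wp_conseq:
  assumes "wp M c P s" and "\<And>s'. P s' \<Longrightarrow> same (writes c) (writes_arr c) s s' \<Longrightarrow> Q s'"
  shows "wp M c Q s"
  using assms exec_same unfolding wp_def by blast

lemma wp_Skip: "Q s \<Longrightarrow> wp M Skip Q s"
  unfolding wp_def using exec.Skip by (metis order_refl time_bound.simps(1))

lemma wp_Assign: "Q ((fst s)(x := eval e s), snd s) \<Longrightarrow> wp M (Assign x e) Q s"
  unfolding wp_def
  using exec.Assign[of x e "fst s" "snd s"] by (metis order_refl prod.collapse time_bound.simps(2))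

lemma wp_Store:
  "Q (fst s, (snd s)(a := (snd s a)(eval i s := eval e s))) \<Longrightarrow> wp M (Store a i e) Q s"
  unfolding wp_def
  using exec.Store[of a i e "fst s" "snd s"] by (metis order_refl prod.collapse time_bound.simps(3))

lemma wp_Seq:
  assumes "wp M c1 (wp M c2 Q) s"
  shows "wp M (c1 ;; c2) Q s"
proof -
  from assms obtain t1 s1 t2 s2 where "exec c1 s t1 s1" "t1 \<le> time_bound M c1"
    "exec c2 s1 t2 s2" "t2 \<le> time_bound M c2" "Q s2"
    unfolding wp_def by blast
  then show ?thesis unfolding wp_def
    by (intro exI[of _ "t1 + t2"] exI[of _ s2]) (auto intro: exec.Seq)
qed

lemma wp_Cond:
  assumes "eval b s \<noteq> 0 \<Longrightarrow> wp M c1 Q s" and "eval b s = 0 \<Longrightarrow> wp M c2 Q s"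
  shows "wp M (Cond b c1 c2) Q s"
proof (cases "eval b s = 0")
  case True
  with assms obtain t s' where "exec c2 s t s'" "t \<le> time_bound M c2" "Q s'"
    unfolding wp_def by blast
  with True show ?thesis unfolding wp_def
    by (intro exI[of _ "1 + cost b + t"] exI[of _ s']) (auto intro: exec.CondFalse[simplified])
next
  case False
  with assms obtain t s' where "exec c1 s t s'" "t \<le> time_bound M c1" "Q s'"
    unfolding wp_def by blast
  with False show ?thesis unfolding wp_def
    by (intro exI[of _ "1 + cost b + t"] exI[of _ s']) (auto intro: exec.CondTrue[simplified])
qed

lemmas wp_intros = wp_Skip wp_Assign wp_Store wp_Seq wp_Cond

text \<open>Truncated subtraction serves as comparison: the test is nonzero exactly while the
  counter is below \<open>e\<close>.\<close>

definition For :: "nat \<Rightarrow> exp \<Rightarrow> com \<Rightarrow> com" where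
  "For x e c = Assign x (Const 0) ;;
    While (Minus e (Reg x)) (c ;; Assign x (Plus (Reg x) (Const 1)))"

lemma writes_For [simp]: "writes (For x e c) = insert x (writes c)"
  and writes_arr_For [simp]: "writes_arr (For x e c) = writes_arr c"
  by (auto simp: For_def)

text \<open>The conditions on reads and writes keep the value of \<open>e\<close> equal to
  \<open>n\<close> throughout, so there are exactly \<open>n\<close> iterations and n \<le> M gives
  the time bound. The increment of the counter is built into the step condition.\<close>

lemma wp_For:
  assumes n: "eval e s = n" "n \<le> M"
    and x: "x \<notin> reads e" "x \<notin> writes c"
    and frame: "reads e \<inter> writes c = {}" "reads_arr e \<inter> writes_arr c = {}"
    and init: "I 0 ((fst s)(x := 0), snd s)"
    and step: "\<And>i s'. i < n \<Longrightarrow> fst s' x = i \<Longrightarrow>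
        same (insert x (writes c)) (writes_arr c) s s' \<Longrightarrow> I i s' \<Longrightarrow>
        wp M c (\<lambda>s''. I (Suc i) ((fst s'')(x := Suc i), snd s'')) s'"
    and post: "\<And>s'. fst s' x = n \<Longrightarrow> same (insert x (writes c)) (writes_arr c) s s' \<Longrightarrow>
        I n s' \<Longrightarrow> Q s'"
  shows "wp M (For x e c) Q s"
proof -
  let ?W = "While (Minus e (Reg x)) (c ;; Assign x (Plus (Reg x) (Const 1)))"
  \<comment> \<open>Time of one test, of the body, and of the increment, which costs 4. The final
    failing test is covered by the extra 1 in \<open>n - i + 1\<close> below.\<close>
  let ?b = "1 + (1 + cost e + 1) + time_bound M c + 4"
  let ?S = "same (insert x (writes c)) (writes_arr c) s"
  have e: "eval e s' = n" if "?S s'" for s'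
    using eval_same[OF that] x frame n by auto
  have loop: "\<exists>t s''. exec ?W s' t s'' \<and> t \<le> (n - i + 1) * ?b \<and> fst s'' x = n \<and> ?S s'' \<and> I n s''"
    if "i \<le> n" "fst s' x = i" "?S s'" "I i s'" for i s'
    using that
  proof (induction "n - i" arbitrary: i s')
    case 0
    have "exec ?W s' (1 + cost (Minus e (Reg x))) s'"
      by (rule WhileFalse) (use 0 e in simp)
    with 0 show ?case
      by (intro exI[of _ "1 + cost (Minus e (Reg x))"] exI[of _ s']) auto
  next
    case (Suc d)
    from Suc.hyps(2) have i: "i < n" by simp
    from step[OF this] Suc.prems obtain t s1 where
      s1: "exec c s' t s1" "t \<le> time_bound M c" "I (Suc i) ((fst s1)(x := Suc i), snd s1)"
      unfolding wp_def by blast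
    let ?s2 = "((fst s1)(x := Suc i), snd s1)"
    have fr: "same (writes c) (writes_arr c) s' s1" by (rule exec_same) fact
    have "fst s1 x = i" using same_reg[OF fr] x Suc.prems by simp
    then have "exec (Assign x (Plus (Reg x) (Const 1))) s1 4 ?s2"
      using exec.Assign[of x "Plus (Reg x) (Const 1)" "fst s1" "snd s1"]
      by (simp add: eval_nat_numeral)
    with s1(1) have body: "exec (c ;; Assign x (Plus (Reg x) (Const 1))) s' (t + 4) ?s2"
      by (rule exec.Seq)
    have S2: "?S ?s2"
      using Suc.prems(3) fr by (auto simp: same_def)
    have "\<exists>t s3. exec ?W ?s2 t s3 \<and> t \<le> (n - Suc i + 1) * ?b \<and> fst s3 x = n \<and> ?S s3 \<and> I n s3"
      by (rule Suc.hyps(1)[OF _ _ _ S2 s1(3)]) (use Suc.hyps(2) i in auto)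
    then obtain t' s3 where
      s3: "exec ?W ?s2 t' s3" "t' \<le> (n - Suc i + 1) * ?b" "fst s3 x = n" "?S s3" "I n s3"
      by blast
    have "exec ?W s' (1 + cost (Minus e (Reg x)) + (t + 4) + t') s3"
      by (rule WhileTrue[OF _ body s3(1)]) (use i Suc.prems e in simp)
    moreover have "(n - i + 1) * ?b = ?b + (n - Suc i + 1) * ?b"
      using i by (simp add: Suc_diff_Suc[symmetric] del: Suc_diff_Suc)
    then have "1 + cost (Minus e (Reg x)) + (t + 4) + t' \<le> (n - i + 1) * ?b"
      using s1(2) s3(2) by simp
    ultimately show ?case using s3 by blast
  qed
  let ?s0 = "((fst s)(x := 0), snd s)"
  have "?S ?s0" by (auto simp: same_def)
  with loop[of 0 ?s0] init obtain t s'' where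
    t: "exec ?W ?s0 t s''" "t \<le> (n + 1) * ?b" "fst s'' x = n" "?S s''" "I n s''"
    by auto
  have "exec (Assign x (Const 0)) s 2 ?s0"
    using exec.Assign[of x "Const 0" "fst s" "snd s"] by (simp add: eval_nat_numeral)
  then have ex: "exec (For x e c) s (2 + t) s''"
    unfolding For_def by (rule exec.Seq) fact
  have "(n + 1) * ?b \<le> (M + 1) * ?b" using n(2) by (intro mult_right_mono) auto
  with t(2) have "2 + t \<le> time_bound M (For x e c)"
    by (simp add: For_def algebra_simps)
  with ex post t show ?thesis unfolding wp_def by blast
qed


section \<open>Coding factorisations by short bit strings\<close>

text \<open>\<open>P\<close> assigns to each column below \<open>j\<close> the start of its chunk of length \<open>h\<close> in the bit
  string \<open>b\<close>; the chunks below \<open>q\<close> are in use, and the first bit of a chunk is its flag.\<close>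

inductive pointers ::
    "(nat \<Rightarrow> bool) \<Rightarrow> (nat \<Rightarrow> nat \<Rightarrow> bool) \<Rightarrow> nat \<Rightarrow> (nat \<Rightarrow> nat) \<Rightarrow> nat \<Rightarrow> nat \<Rightarrow> bool"
  for b E h P where
  start: "pointers b E h P 0 0"
| copy: "pointers b E h P j q \<Longrightarrow> j' < j \<Longrightarrow> b (P j') \<Longrightarrow> E j' j \<Longrightarrow> P j = P j' \<Longrightarrow>
    pointers b E h P (Suc j) q"
| new: "pointers b E h P j q \<Longrightarrow> \<forall>j' < j. \<not> (b (P j') \<and> E j' j) \<Longrightarrow> P j = q \<Longrightarrow>
    pointers b E h P (Suc j) (q + h)"

lemma pointers_cong:
  assumes "pointers b E h P j q" and "\<And>j'. j' < j \<Longrightarrow> P' j' = P j'"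
  shows "pointers b E h P' j q"
  using assms
proof (induction rule: pointers.induct)
  case (copy j q j')
  then show ?case by (intro pointers.copy[of b E h P' j q j']) auto
next
  case (new j q)
  then show ?case by (intro pointers.new) auto
qed (rule pointers.start)

text \<open>\<open>rep j\<close> is the column whose chunk column \<open>j\<close> will use: the
  first column of its class if \<open>j\<close> is good, and \<open>j\<close> itself otherwise. The
  fresh columns are those that open a chunk.\<close>

lemma representative:
  assumes equiv: "equivp E"
    and fresh: "fresh = (\<lambda>j. \<not> good j \<or> (\<forall>i < j. \<not> E i j))"
    and rep: "\<And>j. \<not> good j \<Longrightarrow> rep j = j" "\<And>j. good j \<Longrightarrow> rep j = (LEAST i. E i j)"
  shows "E (rep j) j" and "rep j \<le> (j::nat)" and "fresh (rep j)"
proof -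
  have refl: "E i i" for i using equiv by (simp add: equivp_reflp)
  show rep_eq: "E (rep j) j"
    by (cases "good j") (auto simp: rep refl intro: LeastI[of "\<lambda>i. E i j" j])
  show "rep j \<le> j"
    by (cases "good j") (auto simp: rep intro: Least_le refl)
  show "fresh (rep j)"
  proof (cases "good j")
    case True
    have "\<not> E i (rep j)" if "i < rep j" for i
    proof
      assume "E i (rep j)"
      then have "E i j" using rep_eq by (rule equivp_transp[OF equiv])
      then have "rep j \<le> i" unfolding rep(2)[OF True] by (rule Least_le)
      with that show False by simp
    qed
    then show ?thesis by (simp add: fresh)
  qed (simp add: fresh rep)
qed

text \<open>Flags are known only at the chunks of fresh columns. The induction shows that every
  pointer set so far leads to such a chunk, so the flags read are correct. Hence exactly the fresh
  columns open chunks, and counting them gives the positions.\<close>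

lemma pointers_value:
  assumes "pointers b E h P j q"
    and "j \<le> n"
    and equiv: "equivp E" and good: "\<And>i j. E i j \<Longrightarrow> good i = good j"
    and fresh: "fresh = (\<lambda>j. \<not> good j \<or> (\<forall>i < j. \<not> E i j))"
    and rep: "\<And>j. \<not> good j \<Longrightarrow> rep j = j" "\<And>j. good j \<Longrightarrow> rep j = (LEAST i. E i j)"
    and flag: "\<And>j. j < n \<Longrightarrow> fresh j \<Longrightarrow> b (h * card {i. i < j \<and> fresh i}) = good j"
  shows "q = h * card {i. i < j \<and> fresh i} \<and>
    (\<forall>i < j. P i = h * card {i'. i' < rep i \<and> fresh i'})"
  using assms(1,2)
proof (induction rule: pointers.induct)
  case start
  show ?case by simp
next
  have sym: "E i j \<Longrightarrow> E j i" for i j using equiv by (simp add: equivp_symp)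
  have trans: "E i j \<Longrightarrow> E j k \<Longrightarrow> E i k" for i j k using equiv by (rule equivp_transp)
  note rep_props = representative[OF equiv fresh rep]
  have rep_cong: "rep i = rep j" if "E i j" "good j" for i j
  proof -
    have "E k i = E k j" for k
      using trans[of k i j] trans[of k j i] sym[OF that(1)] that(1) by blast
    then show ?thesis using that good[OF that(1)] rep(2) by simp
  qed
  \<comment> \<open>The flag read for \<open>i\<close> is that of \<open>rep i\<close>; both lie in
    one class, so they are both good or both not.\<close>
  have flag_rep: "b (h * card {i'. i' < rep i \<and> fresh i'}) = good i" if "i < n" for i
    using flag[OF _ rep_props(3)] rep_props(2)[of i] that good[OF rep_props(1)[of i]] by simp
  have card_Suc: "card {i. i < Suc j \<and> fresh i} = card {i. i < j \<and> fresh i} + of_bool (fresh j)" for j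
  proof -
    have "{i. i < Suc j \<and> fresh i} = (if fresh j then insert j else id) {i. i < j \<and> fresh i}"
      by (auto simp: less_Suc_eq)
    then show ?thesis by simp
  qed
  {
    case (copy j q j')
    then have IH: "q = h * card {i. i < j \<and> fresh i}"
      "\<And>i. i < j \<Longrightarrow> P i = h * card {i'. i' < rep i \<and> fresh i'}" by simp_all
    have "good j'"
      using flag_rep[of j'] IH(2)[OF copy.hyps(2)] copy.hyps(2,3) copy.prems by simp
    then have "good j" using good[OF copy.hyps(4)] by simp
    then have "rep j' = rep j" "\<not> fresh j"
      using rep_cong[OF copy.hyps(4)] copy.hyps(2,4) by (auto simp: fresh)
    with IH copy.hyps show ?case using card_Suc[of j] by (auto elim!: less_SucE)
  next
    case (new j q)
    then have IH: "q = h * card {i. i < j \<and> fresh i}"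
      "\<And>i. i < j \<Longrightarrow> P i = h * card {i'. i' < rep i \<and> fresh i'}" by simp_all
    have "\<not> (good j' \<and> E j' j)" if "j' < j" for j'
      using new.hyps(2) flag_rep[of j'] that IH(2)[OF that] new.prems by simp
    then have fr: "fresh j" using good by (auto simp: fresh)
    moreover have "rep j = j"
    proof (cases "good j")
      case True
      then have "\<not> rep j < j" using fr rep_props(1)[of j] by (auto simp: fresh)
      with rep_props(2)[of j] show ?thesis by simp
    qed (simp add: rep)
    ultimately show ?case using IH new.hyps card_Suc[of j] by (auto elim!: less_SucE)
  }
qed

lemma ex_bits: "\<exists>v < 2 ^ N. \<forall>t < N. bit (v::nat) t = F t"
proof (intro exI conjI allI impI)
  let ?v = "horner_sum of_bool 2 (map F [0..<N]) :: nat"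
  show "?v < 2 ^ N" using horner_sum_bound[of "map F [0..<N]", where 'a = nat] by simp
  show "bit ?v t = F t" if "t < N" for t
    using that by (simp add: bit_horner_sum_bit_iff)
qed

section \<open>Costs of factorisations and of the bit strings that code them\<close>

locale gnrm =
  fixes m n R kmax :: nat and u f :: "nat \<Rightarrow> nat \<Rightarrow> bool"
begin

text \<open>Infinity is replaced by \<open>kmax + 1\<close>, which exceeds the budget by itself, so
  comparing a sum with any c \<le> kmax gives the same answer.\<close>

definition weight :: "nat \<Rightarrow> nat \<Rightarrow> bool \<Rightarrow> nat" where
  "weight i j x = (if x = u i j then 0 else if f i j then 1 else kmax + 1)"

definition total :: "nat \<Rightarrow> (nat \<Rightarrow> nat \<Rightarrow> bool) \<Rightarrow> (nat \<Rightarrow> nat \<Rightarrow> bool) \<Rightarrow> nat" where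
  "total r ua pa = (\<Sum>i<m. \<Sum>j<n. weight i j (\<exists>l<r. ua i l \<and> pa l j))"

definition attainable :: "nat \<Rightarrow> nat \<Rightarrow> bool" where
  "attainable r c \<longleftrightarrow> (\<exists>ua pa. total r ua pa \<le> c)"

definition row_cost :: "nat \<Rightarrow> (nat \<Rightarrow> bool) \<Rightarrow> (nat \<Rightarrow> nat) \<Rightarrow> nat \<Rightarrow> nat \<Rightarrow> nat" where
  "row_cost r b P i S = (\<Sum>j<n. weight i j (\<exists>l<r. bit S l \<and> b (P j + l + 1)))"

text \<open>Rows are independent once the second factor is fixed, so the minima can be summed. The
  inserted \<open>kmax + 1\<close> is the start value of the program's running minimum; a row that
  ends there already breaks the budget.\<close>

definition min_cost :: "nat \<Rightarrow> (nat \<Rightarrow> bool) \<Rightarrow> (nat \<Rightarrow> nat) \<Rightarrow> nat" where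
  "min_cost r b P = (\<Sum>i<m. Min (insert (kmax + 1) (row_cost r b P i ` {..<2 ^ r})))"

definition col_eq :: "nat \<Rightarrow> nat \<Rightarrow> bool" where
  "col_eq j j' \<longleftrightarrow> (\<forall>i<m. u i j = u i j')"

text \<open>Chunks have \<open>R + 1\<close> bits even when only r \<le> R roles are in use, so one
  layout and one range of bit strings serve all r.\<close>

definition bits :: nat where
  "bits = (R + 1) * (2 ^ R + kmax)"

text \<open>The bit string \<open>v\<close>, continued arbitrarily, describes a factor of cost at most
  \<open>c\<close>.\<close>

definition achieves :: "nat \<Rightarrow> nat \<Rightarrow> nat \<Rightarrow> bool" where
  "achieves r v c \<longleftrightarrow> (\<forall>b P q. (\<forall>t < bits. b t = bit v t) \<longrightarrow>
    pointers b col_eq (R + 1) P n q \<longrightarrow> min_cost r b P \<le> c)"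

text \<open>Soundness of the enumeration: within the budget, each row minimum is attained at some
  set of roles. These sets form the rows of the first factor, and the columns of the second are read
  off \<open>b\<close>.\<close>

lemma min_cost_attainable:
  assumes "min_cost r b P \<le> kmax"
  shows "attainable r (min_cost r b P)"
proof -
  let ?A = "\<lambda>i. insert (kmax + 1) (row_cost r b P i ` {..<2 ^ r})"
  have "\<exists>S. Min (?A i) = row_cost r b P i S" if "i < m" for i
  proof -
    have "Min (?A i) \<le> min_cost r b P"
      unfolding min_cost_def using that by (intro member_le_sum) auto
    then have "Min (?A i) \<noteq> kmax + 1" using assms by simp
    moreover have "Min (?A i) \<in> ?A i" by (rule Min_in) auto
    ultimately show ?thesis by blast
  qed
  then obtain S where S: "\<And>i. i < m \<Longrightarrow> Min (?A i) = row_cost r b P i (S i)" by metis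
  have "total r (\<lambda>i. bit (S i)) (\<lambda>l j. b (P j + l + 1)) = min_cost r b P"
    unfolding total_def min_cost_def
    by (intro sum.cong refl, subst S) (simp_all only: lessThan_iff row_cost_def)
  then show ?thesis unfolding attainable_def by (metis order_refl)
qed

text \<open>Replace the columns of a good class, one in which some column of the product is exact, by
  that exact column.  The bit string then needs one chunk for each good class, of which there
  are at most \<open>2 ^ r\<close>, and one for each inexact column, of which there are at most
  \<open>c\<close>.\<close>

lemma attainable_bits:
  assumes "attainable r c" and "c \<le> kmax" and "r \<le> R"
  shows "\<exists>v < 2 ^ bits. achieves r v c"
proof -
  from assms(1) obtain ua pa where total: "total r ua pa \<le> c"
    unfolding attainable_def by blast
  define prod where "prod = (\<lambda>i j. \<exists>l<r. ua i l \<and> pa l j)"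
  define exact where "exact = (\<lambda>j. \<forall>i<m. prod i j = u i j)"
  define good where "good = (\<lambda>j. \<exists>z<n. exact z \<and> col_eq z j)"
  define z where "z = (\<lambda>j. if good j then (SOME z. exact z \<and> col_eq z j) else j)"
  define fresh where "fresh = (\<lambda>j. \<not> good j \<or> (\<forall>i < j. \<not> col_eq i j))"
  define rep where "rep = (\<lambda>j. if good j then (LEAST i. col_eq i j) else j)"
  define idx where "idx = (\<lambda>j. card {i. i < j \<and> fresh i})"
  let ?F = "{j. j < n \<and> fresh j}"
  have equiv: "equivp col_eq"
    by (rule equivpI) (auto simp: col_eq_def reflp_def symp_def transp_def)
  have good_cong: "good i = good j" if "col_eq i j" for i j
    using that unfolding good_def col_eq_def by simp
  have z: "exact (z j)" "col_eq (z j) j" if "good j" for j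
  proof -
    have "\<exists>z. exact z \<and> col_eq z j" using that unfolding good_def by blast
    from someI_ex[OF this] show "exact (z j)" "col_eq (z j) j" using that by (auto simp: z_def)
  qed

  \<comment> \<open>A column that is not good is inexact itself, so it costs at least 1.\<close>
  have inexact: "card {j. j < n \<and> \<not> good j} \<le> c"
  proof -
    have "1 \<le> (\<Sum>i<m. weight i j (prod i j))" if "j < n" "\<not> good j" for j
    proof -
      have "\<not> exact j" using that equiv unfolding good_def by (auto simp: equivp_reflp)
      then obtain i where i: "i < m" "prod i j \<noteq> u i j" unfolding exact_def by blast
      then have "1 \<le> weight i j (prod i j)" by (simp add: weight_def)
      also have "\<dots> \<le> (\<Sum>i<m. weight i j (prod i j))"
        using i by (intro member_le_sum) auto
      finally show ?thesis .
    qed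
    then have "card {j. j < n \<and> \<not> good j} \<le> (\<Sum>j | j < n \<and> \<not> good j. \<Sum>i<m. weight i j (prod i j))"
      by (subst card_eq_sum) (intro sum_mono, simp)
    also have "\<dots> \<le> (\<Sum>j<n. \<Sum>i<m. weight i j (prod i j))"
      by (rule sum_mono2) auto
    also have "\<dots> = total r ua pa"
      unfolding total_def prod_def by (rule sum.swap)
    finally show ?thesis using total by simp
  qed
  \<comment> \<open>A good class is determined by the set of roles in column \<open>z j\<close> of
    \<open>pa\<close>: this set fixes column \<open>z j\<close> of the product, which is
    exact.\<close>
  have classes: "card {j. j < n \<and> good j \<and> fresh j} \<le> 2 ^ r"
  proof -
    let ?g = "\<lambda>j. {l. l < r \<and> pa l (z j)}"
    have "inj_on ?g {j. j < n \<and> good j \<and> fresh j}"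
    proof (rule inj_onI, goal_cases)
      case (1 i j)
      then have "prod i' (z i) = prod i' (z j)" for i' unfolding prod_def by blast
      with 1 z[of i] z[of j] have "col_eq i j" unfolding exact_def col_eq_def by auto
      moreover from this have "col_eq j i" using equiv by (simp add: equivp_symp)
      ultimately show "i = j" using 1 by (cases i j rule: linorder_cases) (auto simp: fresh_def)
    qed
    then have "card {j. j < n \<and> good j \<and> fresh j} \<le> card (Pow {..<r})"
      by (rule card_inj_on_le) auto
    then show ?thesis by (simp add: card_Pow)
  qed
  have "?F \<subseteq> {j. j < n \<and> \<not> good j} \<union> {j. j < n \<and> good j \<and> fresh j}"
    by auto
  then have "card ?F \<le> card ({j. j < n \<and> \<not> good j} \<union> {j. j < n \<and> good j \<and> fresh j})"
    by (intro card_mono) auto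
  also have "\<dots> \<le> 2 ^ r + c"
    using card_Un_le[of "{j. j < n \<and> \<not> good j}" "{j. j < n \<and> good j \<and> fresh j}"]
      inexact classes by linarith
  finally have card_fresh: "card ?F \<le> 2 ^ R + kmax"
    using assms(2) power_increasing[OF assms(3), of "2::nat"] by linarith
  have idx_less: "idx i < idx j" if "i < j" "fresh i" for i j
    unfolding idx_def using that by (intro psubset_card_mono) auto
  have idx_inj: "inj_on idx ?F"
  proof (rule inj_onI, goal_cases)
    case (1 i j)
    then show ?case using idx_less[of i j] idx_less[of j i] by (cases i j rule: linorder_cases) auto
  qed
  have idx_bound: "idx j < 2 ^ R + kmax" if "j < n" "fresh j" for j
  proof -
    have "idx j < card ?F" unfolding idx_def using that by (intro psubset_card_mono) auto
    with card_fresh show ?thesis by simp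
  qed
  have in_range: "(R + 1) * idx j + l < bits" if "j < n" "fresh j" "l \<le> R" for j l
  proof -
    have "(R + 1) * idx j + l < (R + 1) * (idx j + 1)" using that by (simp add: algebra_simps)
    also have "\<dots> \<le> bits"
      unfolding bits_def using idx_bound[OF that(1,2)] by (intro mult_left_mono) auto
    finally show ?thesis .
  qed

  define chunk where "chunk = (\<lambda>j l. if l = 0 then good j else pa (l - 1) (z j))"
  \<comment> \<open>Position t has offset \<open>t mod (R + 1)\<close> in chunk number
    \<open>t div (R + 1)\<close>; the inverse of \<open>idx\<close> finds the fresh column that
    opens this chunk.\<close>
  obtain v :: nat where v: "v < 2 ^ bits"
    "\<And>t. t < bits \<Longrightarrow> bit v t = chunk (inv_into ?F idx (t div (R + 1))) (t mod (R + 1))"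
    using ex_bits[of bits "\<lambda>t. chunk (inv_into ?F idx (t div (R + 1))) (t mod (R + 1))"]
    by blast
  have bit_v: "bit v ((R + 1) * idx j + l) = chunk j l" if "j < n" "fresh j" "l \<le> R" for j l
  proof -
    have "((R + 1) * idx j + l) div (R + 1) = idx j" "((R + 1) * idx j + l) mod (R + 1) = l"
      using that(3) by (simp_all del: mult_Suc)
    moreover have "inv_into ?F idx (idx j) = j"
      by (rule inv_into_f_f[OF idx_inj]) (use that in simp)
    ultimately show ?thesis using v(2)[OF in_range[OF that]] by (simp only:)
  qed
  have main: "min_cost r b P \<le> c"
    if b: "\<And>t. t < bits \<Longrightarrow> b t = bit v t" and P: "pointers b col_eq (R + 1) P n q" for b P q
  proof -
    have bc: "b ((R + 1) * idx j + l) = chunk j l" if "j < n" "fresh j" "l \<le> R" for j l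
      using b[OF in_range[OF that]] bit_v[OF that] by simp
    have "q = (R + 1) * card {i. i < n \<and> fresh i} \<and>
        (\<forall>i < n. P i = (R + 1) * card {i'. i' < rep i \<and> fresh i'})"
    proof (rule pointers_value[OF P order_refl equiv good_cong fresh_def])
      show "b ((R + 1) * card {i. i < j \<and> fresh i}) = good j" if "j < n" "fresh j" for j
        using bc[OF that, of 0] unfolding idx_def chunk_def by simp
    qed (simp_all add: rep_def)
    then have P: "P j = (R + 1) * idx (rep j)" if "j < n" for j using that unfolding idx_def by blast
    \<comment> \<open>For a good column, \<open>z (rep j)\<close> is exact and belongs to the same
      class, so the new entry costs nothing. Otherwise \<open>z (rep j) = j\<close> and the entry is
      unchanged.\<close>
    have entry: "weight i j (\<exists>l<r. ua i l \<and> b (P j + l + 1)) \<le> weight i j (prod i j)"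
      if ij: "i < m" "j < n" for i j
    proof -
      have rep: "\<And>j. \<not> good j \<Longrightarrow> rep j = j" "\<And>j. good j \<Longrightarrow> rep j = (LEAST i. col_eq i j)"
        by (simp_all add: rep_def)
      note rep_props = representative[OF equiv fresh_def rep, of j]
      have bits: "b (P j + l + 1) = pa l (z (rep j))" if "l < r" for l
        using bc[of "rep j" "l + 1"] that assms(3) rep_props(2,3) ij(2) P[OF ij(2)]
        by (simp add: chunk_def add.assoc)
      then have "(\<exists>l<r. ua i l \<and> b (P j + l + 1)) = prod i (z (rep j))"
        unfolding prod_def by auto
      moreover have "prod i (z (rep j)) = u i j" if "good j"
        using z[of "rep j"] good_cong[OF rep_props(1)] that rep_props(1) ij
        unfolding exact_def col_eq_def by simp
      moreover have "z (rep j) = j" if "\<not> good j"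
        using that by (simp add: rep_def z_def)
      ultimately show ?thesis by (cases "good j") (simp_all add: weight_def)
    qed
    have "Min (insert (kmax + 1) (row_cost r b P i ` {..<2 ^ r})) \<le> (\<Sum>j<n. weight i j (prod i j))"
      if "i < m" for i
    proof -
      obtain S :: nat where S: "S < 2 ^ r" "\<And>l. l < r \<Longrightarrow> bit S l = ua i l"
        using ex_bits[of r "ua i"] by blast
      have "Min (insert (kmax + 1) (row_cost r b P i ` {..<2 ^ r})) \<le> row_cost r b P i S"
        using S(1) by (intro Min_le) auto
      also have "\<dots> = (\<Sum>j<n. weight i j (\<exists>l<r. ua i l \<and> b (P j + l + 1)))"
        unfolding row_cost_def using S(2) by (intro sum.cong refl arg_cong2[of _ _ _ _ "weight i"]) auto
      also have "\<dots> \<le> (\<Sum>j<n. weight i j (prod i j))"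
        using entry[OF that] by (intro sum_mono) auto
      finally show ?thesis .
    qed
    then have "min_cost r b P \<le> total r ua pa"
      unfolding min_cost_def total_def prod_def by (intro sum_mono) auto
    with total show ?thesis by simp
  qed
  show ?thesis
    using v(1) main unfolding achieves_def by (intro exI[of _ v] conjI allI impI) simp_all
qed

end


section \<open>Enumerating the factorisations\<close>

text \<open>
  Registers: 2 and 3 the dimensions, 4 \<open>rmax\<close>, 5 \<open>kmax + 1\<close>, 6 the offset from an entry to its
  label, 7 the number of bits, 9 the least cost so far, 10 the output length, 12 the current
  \<open>r\<close>, 13 its least cost so far, 14 the bit string, 15 the next free chunk, 16 and 18 columns,
  17 and 20 Boolean flags, 19 a row, 21 the total cost, 22 the least cost of a row, 23 a set of roles,
  24 its cost, 25 an entry of the product, 26 a role, 27 to 29 scratch; 11 and 28 are loop counters.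
  Arrays: 0 input and output, 2 the position of each row in the input, 3 powers of two,
  4 the bits, 5 the chunk used by each column, 6 the current set of roles, 7 the collected front.
\<close>

definition decode :: "nat \<Rightarrow> nat \<Rightarrow> nat \<Rightarrow> com" where
  "decode a v c =
    Assign 27 (Reg v) ;;
    For 28 (Reg c) (
      Assign 29 (Minus (Minus (Reg c) (Const 1)) (Reg 28)) ;;
      Cond (Minus (Plus (Reg 27) (Const 1)) (Elem 3 (Reg 29)))
        (Assign 27 (Minus (Reg 27) (Elem 3 (Reg 29))) ;; Store a (Reg 29) (Const 1))
        (Store a (Reg 29) (Const 0)))"

lemma writes_decode [simp]: "writes (decode a v c) = {27, 28, 29}"
  and writes_arr_decode [simp]: "writes_arr (decode a v c) = {a}"
  by (auto simp: decode_def)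

lemma wp_decode:
  assumes "v \<notin> {27, 28, 29}" "c \<notin> {27, 28, 29}" "a \<noteq> 3"
    and c: "fst s c = N" "N \<le> M" and v: "fst s v < 2 ^ N"
    and pow: "\<And>i. i < N \<Longrightarrow> snd s 3 i = 2 ^ i"
  shows "wp M (decode a v c) (\<lambda>s'. \<forall>i < N. (snd s' a i \<noteq> 0) = bit (fst s v) i) s"
  unfolding decode_def
proof (intro wp_Seq wp_Assign, rule wp_For[where n = N and I = "\<lambda>x s'. fst s' 27 = take_bit (N - x) (fst s v) \<and>
    (\<forall>i < N. i \<ge> N - x \<longrightarrow> (snd s' a i \<noteq> 0) = bit (fst s v) i)"], goal_cases)
  case (8 x s')
  obtain k where k: "N - x = Suc k" "k < N" "N - Suc x = k" using 8(1)
    by (intro that[of "N - Suc x"]) auto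
  have fr: "fst s' c = N" "snd s' 3 k = 2 ^ k"
    using same_reg[OF 8(3), of c] same_arr[OF 8(3), of 3] assms k by simp_all
  \<comment> \<open>The register holds the lowest k + 1 bits. All but the top one amount to less
    than 2 ^ k, so the comparison with 2 ^ k reveals the top bit.\<close>
  have w: "fst s' 27 = 2 ^ k * of_bool (bit (fst s v) k) + take_bit k (fst s v)"
    using 8(4) by (simp only: k take_bit_Suc_from_most)
  have lt: "take_bit k (fst s v) < 2 ^ k" by simp
  have split: "j \<ge> k \<longleftrightarrow> j = k \<or> j \<ge> Suc k" for j by auto
  from 8(4) have old: "\<forall>j < N. j \<ge> Suc k \<longrightarrow> (snd s' a j \<noteq> 0) = bit (fst s v) j"
    unfolding k by blast
  show ?case
    by (intro wp_intros; cases "bit (fst s v) k") (use lt old fr k 8(2) in \<open>auto simp: w split\<close>)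
qed (use assms in \<open>auto simp: take_bit_nat_eq_self\<close>)


section \<open>The programs that evaluate one bit string and enumerate all of them\<close>

abbreviation entry_exp :: "nat \<Rightarrow> nat \<Rightarrow> exp" where
  "entry_exp i j \<equiv> Elem 0 (Plus (Elem 2 (Reg i)) (Reg j))"

abbreviation label_exp :: "nat \<Rightarrow> nat \<Rightarrow> exp" where
  "label_exp i j \<equiv> Elem 0 (Plus (Plus (Elem 2 (Reg i)) (Reg j)) (Reg 6))"

abbreviation differ_exp :: "exp \<Rightarrow> exp \<Rightarrow> exp" where
  "differ_exp a b \<equiv> Plus (Minus a b) (Minus b a)"

definition compare_cols :: com where
  "compare_cols =
    Assign 20 (Const 1) ;;
    For 19 (Reg 2) (
      Cond (differ_exp (entry_exp 19 18) (entry_exp 19 16)) (Assign 20 (Const 0)) Skip)"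

text \<open>The loop does not stop at a match, so the last match wins; \<open>pointers.copy\<close>
  therefore admits any matching earlier column.\<close>

definition find_copy :: com where
  "find_copy =
    For 18 (Reg 16) (
      Cond (Elem 4 (Elem 5 (Reg 18)))
        (compare_cols ;;
         Cond (Reg 20) (Store 5 (Reg 16) (Elem 5 (Reg 18)) ;; Assign 17 (Const 1)) Skip)
        Skip)"

text \<open>The next free chunk is entered provisionally; \<open>find_copy\<close> overwrites it if
  an earlier column can be copied.\<close>

definition place :: com where
  "place =
    Assign 15 (Const 0) ;;
    For 16 (Reg 3) (
      Store 5 (Reg 16) (Reg 15) ;;
      Assign 17 (Const 0) ;;
      find_copy ;;
      Cond (Reg 17) Skip (Assign 15 (Plus (Reg 15) (Plus (Reg 4) (Const 1)))))"

definition product_entry :: com where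
  "product_entry =
    Assign 25 (Const 0) ;;
    For 26 (Reg 12) (
      Cond (Elem 6 (Reg 26))
        (Cond (Elem 4 (Plus (Plus (Elem 5 (Reg 16)) (Reg 26)) (Const 1)))
          (Assign 25 (Const 1)) Skip)
        Skip)"

definition cost_of_row :: com where
  "cost_of_row =
    Assign 24 (Const 0) ;;
    For 16 (Reg 3) (
      product_entry ;;
      Cond (differ_exp (Reg 25) (entry_exp 19 16))
        (Cond (label_exp 19 16) (Assign 24 (Plus (Reg 24) (Const 1)))
          (Assign 24 (Plus (Reg 24) (Reg 5))))
        Skip)"

definition best_row :: com where
  "best_row =
    Assign 22 (Reg 5) ;;
    For 23 (Elem 3 (Reg 12)) (
      decode 6 23 12 ;;
      cost_of_row ;;
      Cond (Minus (Reg 22) (Reg 24)) (Assign 22 (Reg 24)) Skip)"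

definition evaluate :: com where
  "evaluate =
    Assign 21 (Const 0) ;;
    For 19 (Reg 2) (best_row ;; Assign 21 (Plus (Reg 21) (Reg 22)))"

definition search :: com where
  "search =
    For 14 (Elem 3 (Reg 7)) (
      decode 4 14 7 ;;
      place ;;
      evaluate ;;
      Cond (Minus (Reg 13) (Reg 21)) (Assign 13 (Reg 21)) Skip)"

lemma writes_routines [simp]:
  "writes compare_cols = {19, 20}"
  "writes find_copy = {17, 18, 19, 20}"
  "writes place = {15, 16, 17, 18, 19, 20}"
  "writes product_entry = {25, 26}"
  "writes cost_of_row = {16, 24, 25, 26}"
  "writes best_row = {16, 22, 23, 24, 25, 26, 27, 28, 29}"
  "writes evaluate = {16, 19, 21, 22, 23, 24, 25, 26, 27, 28, 29}"
  "writes search = {13, 14, 15, 16, 17, 18, 19, 20, 21, 22, 23, 24, 25, 26, 27, 28, 29}"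
  unfolding search_def evaluate_def best_row_def cost_of_row_def product_entry_def place_def
    find_copy_def compare_cols_def
  by auto

lemma writes_arr_routines [simp]:
  "writes_arr compare_cols = {}"
  "writes_arr find_copy = {5}"
  "writes_arr place = {5}"
  "writes_arr product_entry = {}"
  "writes_arr cost_of_row = {}"
  "writes_arr best_row = {6}"
  "writes_arr evaluate = {6}"
  "writes_arr search = {4, 5, 6}"
  unfolding search_def evaluate_def best_row_def cost_of_row_def product_entry_def place_def
    find_copy_def compare_cols_def
  by auto

text \<open>\<open>M\<close> must bound every loop: those over rows, columns, roles, output words
  (at most two for each number of roles), bits, and bit strings.\<close>

locale gnrm_run = gnrm +
  fixes M :: nat
  assumes M: "m \<le> M" "n \<le> M" "2 * R + 1 \<le> M" "bits \<le> M" "2 ^ bits \<le> M"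
begin

definition env :: "state \<Rightarrow> bool" where
  "env s \<longleftrightarrow> fst s 2 = m \<and> fst s 3 = n \<and> fst s 4 = R \<and> fst s 5 = kmax + 1 \<and> fst s 6 = m * n \<and>
    fst s 7 = bits \<and> (\<forall>i<m. snd s 2 i = 4 + i * n) \<and> (\<forall>i\<le>bits. snd s 3 i = 2 ^ i) \<and>
    (\<forall>i<m. \<forall>j<n. snd s 0 (4 + i * n + j) = of_bool (u i j) \<and>
      snd s 0 (4 + i * n + j + m * n) = of_bool (f i j))"

text \<open>\<open>env\<close> looks only at registers up to 7 and arrays up to 3, and the search
  writes only above these.\<close>

lemma env_same:
  assumes "env s" and "same X Y s s'" and "\<And>x. x \<in> X \<Longrightarrow> 7 < x" "\<And>a. a \<in> Y \<Longrightarrow> 3 < a"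
  shows "env s'"
proof -
  have "fst s' x = fst s x" if "x \<le> 7" for x
    using same_reg[OF assms(2)] assms(3) that by (meson leD)
  moreover have "snd s' a = snd s a" if "a \<le> 3" for a
    using same_arr[OF assms(2)] assms(4) that by (meson leD)
  ultimately show ?thesis using assms(1) by (simp add: env_def)
qed

lemma env_regs: "env s \<Longrightarrow> fst s 2 = m" "env s \<Longrightarrow> fst s 3 = n" "env s \<Longrightarrow> fst s 4 = R"
    "env s \<Longrightarrow> fst s 5 = kmax + 1" "env s \<Longrightarrow> fst s 7 = bits"
    "env s \<Longrightarrow> i \<le> bits \<Longrightarrow> snd s 3 i = 2 ^ i"
  by (simp_all add: env_def)

lemma eval_entry_exp [simp]:
  "env s \<Longrightarrow> fst s i < m \<Longrightarrow> fst s j < n \<Longrightarrow> eval (entry_exp i j) s = of_bool (u (fst s i) (fst s j))"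
  by (simp add: env_def)

lemma eval_label_exp [simp]:
  "env s \<Longrightarrow> fst s i < m \<Longrightarrow> fst s j < n \<Longrightarrow> eval (label_exp i j) s = of_bool (f (fst s i) (fst s j))"
  by (simp add: env_def)

lemma eval_differ_exp: "eval (differ_exp a b) s = 0 \<longleftrightarrow> eval a s = eval b s"
  by auto

lemma R_bits: "R < bits" and pow_le: "r \<le> R \<Longrightarrow> 2 ^ r \<le> M"
proof -
  have "1 \<le> (2::nat) ^ R" by simp
  then have "(R + 1) * 1 \<le> bits" unfolding bits_def by (intro mult_left_mono) linarith+
  then show "R < bits" by simp
  then have "(2::nat) ^ r \<le> 2 ^ bits" if "r \<le> R"
    using that by (intro power_increasing) auto
  then show "2 ^ r \<le> M" if "r \<le> R"
    using that M(5) by (meson order_trans)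
qed

section \<open>Correctness of the routines of the search\<close>

lemma wp_compare_cols:
  assumes "env s" "fst s 16 < n" "fst s 18 < n"
  shows "wp M compare_cols (\<lambda>s'. (fst s' 20 \<noteq> 0) = col_eq (fst s 18) (fst s 16)) s"
  unfolding compare_cols_def
proof (intro wp_Seq wp_Assign, rule wp_For[where n = m and
    I = "\<lambda>i s'. (fst s' 20 \<noteq> 0) = (\<forall>i'<i. u i' (fst s 18) = u i' (fst s 16))"], goal_cases)
  case (8 i s')
  have env: "env s'" using assms(1) by (rule env_same[where X = "{19, 20}" and Y = "{}"])
      (use 8(3) in \<open>auto simp: same_def\<close>)
  have j: "fst s' 18 = fst s 18" "fst s' 16 = fst s 16" using 8(3) by (auto simp: same_def)
  have "eval (differ_exp (entry_exp 19 18) (entry_exp 19 16)) s' = 0 \<longleftrightarrow> u i (fst s 18) = u i (fst s 16)"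
    unfolding eval_differ_exp using env j 8(1,2) assms by (subst (1 2) eval_entry_exp) auto
  then show ?case using 8(4)
    by (intro wp_intros) (auto simp: All_less_Suc simp del: eval.simps(4))
qed (use assms M in \<open>auto simp: env_regs col_eq_def\<close>)

text \<open>The loop reads array 5 below \<open>j\<close> and writes it only at \<open>j\<close>, so
  its tests can be stated in terms of the initial state.\<close>

lemma wp_find_copy:
  assumes "env s" "fst s 16 = j" "j < n" "fst s 17 = 0"
  shows "wp M find_copy (\<lambda>s'. (\<forall>i. i \<noteq> j \<longrightarrow> snd s' 5 i = snd s 5 i) \<and>
    (if fst s' 17 = 0
     then snd s' 5 j = snd s 5 j \<and> (\<forall>j'<j. \<not> (snd s 4 (snd s 5 j') \<noteq> 0 \<and> col_eq j' j))
     else \<exists>j'<j. snd s 4 (snd s 5 j') \<noteq> 0 \<and> col_eq j' j \<and> snd s' 5 j = snd s 5 j')) s"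
  unfolding find_copy_def
proof (rule wp_For[where n = j and I = "\<lambda>k s'. (\<forall>i. i \<noteq> j \<longrightarrow> snd s' 5 i = snd s 5 i) \<and>
    (if fst s' 17 = 0
     then snd s' 5 j = snd s 5 j \<and> (\<forall>j'<k. \<not> (snd s 4 (snd s 5 j') \<noteq> 0 \<and> col_eq j' j))
     else \<exists>j'<k. snd s 4 (snd s 5 j') \<noteq> 0 \<and> col_eq j' j \<and> snd s' 5 j = snd s 5 j')"], goal_cases)
  case (8 k s')
  have env: "env s'" using assms(1) 8(3) by (rule env_same) auto
  have fr: "fst s' 16 = j" "snd s' 4 = snd s 4" using 8(3) assms by (auto simp: same_def)
  have P: "snd s' 5 k = snd s 5 k" using 8(1,4) by simp
  show ?case
  proof (rule wp_Cond, goal_cases)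
    case 1
    have cmp: "wp M compare_cols (\<lambda>s'. (fst s' 20 \<noteq> 0) = col_eq k j) s'"
      using wp_compare_cols[OF env] fr 8(1,2) assms by simp
    show ?case
    proof (rule wp_Seq, rule wp_conseq[OF cmp], rule wp_Cond, goal_cases)
      case (1 s2)
      then have "fst s2 16 = j" "fst s2 18 = k" "snd s2 5 = snd s' 5"
        using fr 8(2) by (auto simp: same_def)
      moreover have "col_eq k j" using 1 by simp
      ultimately show ?case using 8(1,4) P fr \<open>eval (Elem 4 (Elem 5 (Reg 18))) s' \<noteq> 0\<close> 8(2)
        by (intro wp_intros) auto
    next
      case (2 s2)
      then have "fst s2 17 = fst s' 17" "snd s2 5 = snd s' 5" "\<not> col_eq k j"
        using fr 8(2) by (auto simp: same_def)
      then show ?case using 8(4)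
        by (intro wp_Skip) (cases "fst s' 17 = 0"; simp add: All_less_Suc Ex_less_Suc)
    qed
  next
    case 2
    then have "\<not> snd s 4 (snd s 5 k) \<noteq> 0" using fr P 8(2) by simp
    then show ?case using 8(4)
      by (intro wp_Skip) (cases "fst s' 17 = 0"; simp add: All_less_Suc Ex_less_Suc)
  qed
next
  case (9 s')
  show ?case by (rule 9(3))
qed (use assms M in auto)

text \<open>The two outcomes of \<open>find_copy\<close> are the rules \<open>copy\<close> and
  \<open>new\<close> of \<open>pointers\<close>; pointers of earlier columns persist because only
  entry \<open>j\<close> changes.\<close>

lemma wp_place:
  assumes "env s"
  shows "wp M place (\<lambda>s'. \<exists>q. pointers (\<lambda>t. snd s 4 t \<noteq> 0) col_eq (R + 1) (snd s' 5) n q) s"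
  unfolding place_def
proof (intro wp_Seq wp_Assign, rule wp_For[where n = n and
    I = "\<lambda>j s'. pointers (\<lambda>t. snd s 4 t \<noteq> 0) col_eq (R + 1) (snd s' 5) j (fst s' 15)"], goal_cases)
  case (8 j s')
  have env: "env s'" using assms by (rule env_same[where X = "{15, 16, 17, 18, 19, 20}" and Y = "{5}"])
      (use 8(3) in \<open>auto simp: same_def\<close>)
  have fr: "snd s' 4 = snd s 4" using 8(3) by (auto simp: same_def)
  let ?s1 = "((fst s')(17 := 0), (snd s')(5 := (snd s' 5)(j := fst s' 15)))"
  have env1: "env ?s1" using env by (simp add: env_def)
  have fc: "wp M find_copy (\<lambda>s2. (\<forall>i. i \<noteq> j \<longrightarrow> snd s2 5 i = snd s' 5 i) \<and>
    (if fst s2 17 = 0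
     then snd s2 5 j = fst s' 15 \<and> (\<forall>j'<j. \<not> (snd s 4 (snd s' 5 j') \<noteq> 0 \<and> col_eq j' j))
     else \<exists>j'<j. snd s 4 (snd s' 5 j') \<noteq> 0 \<and> col_eq j' j \<and> snd s2 5 j = snd s' 5 j')) ?s1"
    by (rule wp_conseq[OF wp_find_copy[OF env1, of j]]) (use 8(1,2) fr in \<open>auto split: if_splits\<close>)
  have fc': "wp M find_copy (wp M (Cond (Reg 17) Skip (Assign 15 (Plus (Reg 15) (Plus (Reg 4) (Const 1)))))
     (\<lambda>s''. pointers (\<lambda>t. snd s 4 t \<noteq> 0) col_eq (R + 1) (snd ((fst s'')(16 := Suc j), snd s'') 5)
       (Suc j) (fst ((fst s'')(16 := Suc j), snd s'') 15))) ?s1"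
  proof (rule wp_conseq[OF fc], goal_cases)
    case (1 s2)
    have fr2: "fst s2 15 = fst s' 15" "fst s2 4 = R" using 1(2) env by (auto simp: same_def env_regs)
    have old: "pointers (\<lambda>t. snd s 4 t \<noteq> 0) col_eq (R + 1) (snd s2 5) j (fst s' 15)"
      using 8(4) by (rule pointers_cong) (use 1(1) in simp)
    show ?case
    proof (rule wp_Cond, goal_cases)
      case 1
      then obtain j' where "j' < j" "snd s 4 (snd s' 5 j') \<noteq> 0" "col_eq j' j" "snd s2 5 j = snd s' 5 j'"
        using \<open>_ \<and> (if fst s2 17 = 0 then _ else _)\<close> by auto
      moreover from this have "snd s2 5 j' = snd s' 5 j'"
        using \<open>_ \<and> (if fst s2 17 = 0 then _ else _)\<close> by auto
      ultimately show ?case using pointers.copy[OF old, of j'] fr2 by (intro wp_Skip) simp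
    next
      case 2
      then have "snd s2 5 j = fst s' 15" "\<forall>j'<j. \<not> (snd s 4 (snd s2 5 j') \<noteq> 0 \<and> col_eq j' j)"
        using \<open>_ \<and> (if fst s2 17 = 0 then _ else _)\<close> by auto
      then show ?case using pointers.new[OF old] fr2 by (intro wp_Assign) simp
    qed
  qed
  show ?case using fc' 8(2) by (intro wp_Seq wp_Store wp_Assign) simp
qed (use assms M in \<open>auto simp: env_regs intro: pointers.start\<close>)

lemma wp_product_entry:
  assumes "fst s 12 = r" "r \<le> R"
  shows "wp M product_entry (\<lambda>s'. fst s' 25 =
    of_bool (\<exists>l<r. snd s 6 l \<noteq> 0 \<and> snd s 4 (snd s 5 (fst s 16) + l + 1) \<noteq> 0)) s"
  unfolding product_entry_def
proof (intro wp_Seq wp_Assign, rule wp_For[where n = r and I = "\<lambda>k s'. fst s' 25 =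
    of_bool (\<exists>l<k. snd s 6 l \<noteq> 0 \<and> snd s 4 (snd s 5 (fst s 16) + l + 1) \<noteq> 0)"], goal_cases)
  case (8 k s')
  have fr: "fst s' 16 = fst s 16" "snd s' 4 = snd s 4" "snd s' 5 = snd s 5" "snd s' 6 = snd s 6"
    using 8(3) by (auto simp: same_def)
  then show ?case using 8(2,4) by (intro wp_intros) (auto simp: All_less_Suc Ex_less_Suc)
qed (use assms M in auto)

lemma wp_cost_of_row:
  assumes "env s" "fst s 12 = r" "r \<le> R" "fst s 19 = i" "i < m"
  shows "wp M cost_of_row (\<lambda>s'. fst s' 24 =
    (\<Sum>j<n. weight i j (\<exists>l<r. snd s 6 l \<noteq> 0 \<and> snd s 4 (snd s 5 j + l + 1) \<noteq> 0))) s"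
  unfolding cost_of_row_def
proof (intro wp_Seq wp_Assign, rule wp_For[where n = n and I = "\<lambda>k s'. fst s' 24 =
    (\<Sum>j<k. weight i j (\<exists>l<r. snd s 6 l \<noteq> 0 \<and> snd s 4 (snd s 5 j + l + 1) \<noteq> 0))"], goal_cases)
  case (8 j s')
  let ?x = "\<exists>l<r. snd s 6 l \<noteq> 0 \<and> snd s 4 (snd s 5 j + l + 1) \<noteq> 0"
  have fr: "fst s' 12 = r" "snd s' 4 = snd s 4" "snd s' 5 = snd s 5" "snd s' 6 = snd s 6"
    using 8(3) assms by (auto simp: same_def)
  have pe: "wp M product_entry (\<lambda>s''. fst s'' 25 = of_bool ?x) s'"
    using wp_product_entry[of s' r] fr 8(2) assms by simp
  show ?case
  proof (rule wp_Seq, rule wp_conseq[OF pe], goal_cases)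
    case (1 s2)
    have env: "env s2" using assms(1)
      by (rule env_same[where X = "{16, 24, 25, 26}" and Y = "{}"])
        (use 8(3) 1(2) in \<open>auto simp: same_def\<close>)
    have r2: "fst s2 19 = i" "fst s2 16 = j" "fst s2 24 = fst s' 24" "fst s2 5 = kmax + 1"
      using 8(2,3) 1(2) assms env by (auto simp: same_def env_regs)
    have d: "eval (differ_exp (Reg 25) (entry_exp 19 16)) s2 = 0 \<longleftrightarrow> ?x = u i j"
      unfolding eval_differ_exp using env r2 8(1) assms 1(1) by (subst eval_entry_exp) auto
    have l: "eval (label_exp 19 16) s2 = of_bool (f i j)"
      using env r2 8(1) assms by (subst eval_label_exp) auto
    show ?case
    proof (rule wp_Cond, goal_cases)
      case 1
      with d have "?x \<noteq> u i j" by simp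
      then show ?case
        by (intro wp_Cond wp_Assign) (use l 8(4) r2 in \<open>auto simp: weight_def simp del: eval.simps(3)\<close>)
    next
      case 2
      with d have "?x = u i j" by simp
      then show ?case using 8(4) r2 by (intro wp_Skip) (simp add: weight_def)
    qed
  qed
qed (use assms M in \<open>auto simp: env_regs\<close>)

lemma wp_best_row:
  assumes "env s" "fst s 12 = r" "r \<le> R" "fst s 19 = i" "i < m"
  shows "wp M best_row (\<lambda>s'. fst s' 22 =
    Min (insert (kmax + 1) (row_cost r (\<lambda>t. snd s 4 t \<noteq> 0) (snd s 5) i ` {..<2 ^ r}))) s"
proof -
  let ?rc = "row_cost r (\<lambda>t. snd s 4 t \<noteq> 0) (snd s 5) i"
  define mn where "mn = (\<lambda>k. Min (insert (kmax + 1) (?rc ` {..<k})))"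
  have mn_Suc: "mn (Suc k) = min (?rc k) (mn k)" for k
  proof -
    have "mn (Suc k) = Min (insert (?rc k) (insert (kmax + 1) (?rc ` {..<k})))"
      by (simp add: mn_def lessThan_Suc insert_commute)
    then show ?thesis unfolding mn_def by (subst (asm) Min_insert) auto
  qed
  have "wp M best_row (\<lambda>s'. fst s' 22 = mn (2 ^ r)) s"
    unfolding best_row_def
  proof (intro wp_Seq wp_Assign,
      rule wp_For[where n = "2 ^ r" and I = "\<lambda>k s'. fst s' 22 = mn k"], goal_cases)
    case (8 S s')
    have env: "env s'" using assms(1)
      by (rule env_same[where X = "{16, 22, 23, 24, 25, 26, 27, 28, 29}" and Y = "{6}"])
        (use 8(3) in \<open>auto simp: same_def\<close>)
    have fr: "fst s' 12 = r" "fst s' 19 = i" "snd s' 4 = snd s 4" "snd s' 5 = snd s 5"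
      using 8(3) assms by (auto simp: same_def)
    have "wp M (decode 6 23 12) (\<lambda>s''. \<forall>l < r. (snd s'' 6 l \<noteq> 0) = bit (fst s' 23) l) s'"
      by (rule wp_decode) (use fr env 8(1,2) assms(3) M R_bits in \<open>auto simp: env_regs\<close>)
    then have dec: "wp M (decode 6 23 12) (\<lambda>s''. \<forall>l < r. (snd s'' 6 l \<noteq> 0) = bit S l) s'"
      using 8(2) by simp
    show ?case
    proof (rule wp_Seq, rule wp_conseq[OF dec], rule wp_Seq, goal_cases)
      case (1 s2)
      have env2: "env s2" using env 1(2) by (rule env_same) auto
      have fr2: "fst s2 12 = r" "fst s2 19 = i" "fst s2 22 = fst s' 22" "snd s2 4 = snd s 4" "snd s2 5 = snd s 5"
        using 1(2) fr by (auto simp: same_def)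
      have "(\<Sum>j<n. weight i j (\<exists>l<r. snd s2 6 l \<noteq> 0 \<and> snd s2 4 (snd s2 5 j + l + 1) \<noteq> 0)) =
          ?rc S"
        unfolding row_cost_def fr2
        by (intro sum.cong refl arg_cong2[of _ _ _ _ "weight i"]) (use 1(1) in auto)
      with wp_cost_of_row[OF env2 fr2(1) assms(3) fr2(2) assms(5)]
      have row: "wp M cost_of_row (\<lambda>s'. fst s' 24 = ?rc S) s2"
        by simp
      show ?case
      proof (rule wp_conseq[OF row], goal_cases)
        case (1 s3)
        have "fst s3 22 = fst s' 22" using 1(2) fr2 by (auto simp: same_def)
        then show ?case using 1(1) 8(4) by (intro wp_intros) (simp_all add: mn_Suc min_def)
      qed
    qed
  next
    case 1
    then show ?case using assms R_bits by (simp add: env_regs)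
  next
    case 2
    then show ?case using pow_le assms by simp
  qed (use assms M in \<open>auto simp: env_regs mn_def\<close>)
  then show ?thesis by (simp only: mn_def)
qed

lemma wp_evaluate:
  assumes "env s" "fst s 12 = r" "r \<le> R"
  shows "wp M evaluate (\<lambda>s'. fst s' 21 = min_cost r (\<lambda>t. snd s 4 t \<noteq> 0) (snd s 5)) s"
  unfolding evaluate_def
proof (intro wp_Seq wp_Assign, rule wp_For[where n = m and I = "\<lambda>k s'. fst s' 21 = (\<Sum>i<k.
    Min (insert (kmax + 1) (row_cost r (\<lambda>t. snd s 4 t \<noteq> 0) (snd s 5) i ` {..<2 ^ r})))"], goal_cases)
  case (8 i s')
  have env: "env s'" using assms(1)
    by (rule env_same[where X = "{16, 19, 21, 22, 23, 24, 25, 26, 27, 28, 29}" and Y = "{6}"])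
      (use 8(3) in \<open>auto simp: same_def\<close>)
  have fr: "fst s' 12 = r" "snd s' 4 = snd s 4" "snd s' 5 = snd s 5"
    using 8(3) assms by (auto simp: same_def)
  show ?case
  proof (rule wp_Seq, rule wp_conseq[OF wp_best_row[OF env fr(1) assms(3) 8(2,1)]], goal_cases)
    case (1 s2)
    have "fst s2 21 = fst s' 21" using 1(2) by (auto simp: same_def)
    then show ?case using 1(1) 8(4) fr by (intro wp_Assign) simp
  qed
qed (use assms M in \<open>auto simp: env_regs min_cost_def\<close>)

text \<open>\<open>min_cost_attainable\<close> makes every recorded improvement attainable, and
  \<open>attainable_bits\<close> places a witness for every attainable cost within the budget among
  the enumerated strings. So register 13 ends as the smaller of its initial value and the least cost
  for \<open>r\<close>.\<close>

lemma wp_search: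
  assumes "env s" "fst s 12 = r" "r \<le> R" "fst s 13 \<le> kmax + 1"
  shows "wp M search (\<lambda>s'. fst s' 13 \<le> fst s 13 \<and> (\<forall>c < fst s' 13. \<not> attainable r c) \<and>
    (fst s' 13 < fst s 13 \<longrightarrow> attainable r (fst s' 13))) s"
  unfolding search_def
proof (rule wp_For[where n = "2 ^ bits" and I = "\<lambda>k s'. fst s' 13 \<le> fst s 13 \<and>
    (fst s' 13 < fst s 13 \<longrightarrow> attainable r (fst s' 13)) \<and>
    (\<forall>v < k. \<forall>c. achieves r v c \<longrightarrow> fst s' 13 \<le> c)"], goal_cases)
  case (8 v s')
  have env: "env s'" using assms(1) 8(3) by (rule env_same) auto
  have fr: "fst s' 12 = r" using 8(3) assms by (auto simp: same_def)
  have "wp M (decode 4 14 7) (\<lambda>s''. \<forall>t < bits. (snd s'' 4 t \<noteq> 0) = bit (fst s' 14) t) s'"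
    by (rule wp_decode) (use fr env 8(1,2) M in \<open>auto simp: env_regs\<close>)
  then have dec: "wp M (decode 4 14 7) (\<lambda>s''. \<forall>t < bits. (snd s'' 4 t \<noteq> 0) = bit v t) s'"
    using 8(2) by simp
  show ?case
  proof (rule wp_Seq, rule wp_conseq[OF dec], rule wp_Seq, goal_cases)
    case (1 s2)
    note bits2 = 1(1)
    have env2: "env s2" using env 1(2) by (rule env_same) auto
    have fr2: "fst s2 12 = r" "fst s2 13 = fst s' 13" using 1(2) fr by (auto simp: same_def)
    show ?case
    proof (rule wp_conseq[OF wp_place[OF env2]], rule wp_Seq, goal_cases)
      case (1 s3)
      then obtain q where ptr: "pointers (\<lambda>t. snd s2 4 t \<noteq> 0) col_eq (R + 1) (snd s3 5) n q" by blast
      have env3: "env s3" using env2 1(2) by (rule env_same) auto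
      have fr3: "fst s3 12 = r" "fst s3 13 = fst s' 13" "snd s3 4 = snd s2 4"
        using 1(2) fr2 by (auto simp: same_def)
      show ?case
      proof (rule wp_conseq[OF wp_evaluate[OF env3 fr3(1) assms(3)]], goal_cases)
        case (1 s4)
        let ?c = "min_cost r (\<lambda>t. snd s2 4 t \<noteq> 0) (snd s3 5)"
        have fr4: "fst s4 13 = fst s' 13" "fst s4 21 = ?c" using 1 fr3 by (auto simp: same_def)
        have sound: "attainable r ?c" if "?c < fst s' 13"
          using min_cost_attainable[of r] that 8(4) assms(4) by simp
        \<comment> \<open>Array 4 agrees with \<open>v\<close> only below \<open>bits\<close>;
          beyond that it may hold anything, which is why \<open>achieves\<close> quantifies over all
          continuations.\<close>
        have complete: "?c \<le> c" if "achieves r v c" for c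
          using that[unfolded achieves_def, rule_format, OF _ ptr] bits2 by simp
        show ?case
        proof (rule wp_Cond, goal_cases)
          case 1
          then have "?c < fst s' 13" by (simp add: fr4)
          then show ?case using sound complete 8(4)
            by (intro wp_Assign) (auto simp: fr4 less_Suc_eq; fastforce)
        next
          case 2
          then have "fst s' 13 \<le> ?c" by (simp add: fr4)
          then show ?case using complete 8(4)
            by (intro wp_Skip) (auto simp: fr4 less_Suc_eq dest: complete)
        qed
      qed
    qed
  qed
next
  case (9 s')
  have "\<not> attainable r c" if c: "c < fst s' 13" for c
  proof
    assume "attainable r c"
    moreover have "c \<le> kmax" using c 9(3) assms(4) by simp
    ultimately obtain v where "v < 2 ^ bits" "achieves r v c"
      using attainable_bits[OF _ _ assms(3)] by blast
    with 9(3) have "fst s' 13 \<le> c" by blast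
    with c show False by simp
  qed
  with 9(3) show ?case by blast
qed (use assms M in \<open>auto simp: env_regs\<close>)

end


section \<open>The Pareto front\<close>

definition read_header :: com where
  "read_header =
    Assign 2 (Elem 0 (Const 0)) ;;
    Assign 3 (Elem 0 (Const 1)) ;;
    Assign 4 (Elem 0 (Const 2)) ;;
    Assign 5 (Plus (Elem 0 (Const 3)) (Const 1)) ;;
    Cond (Reg 2) Skip (Assign 3 (Const 0)) ;;
    Cond (Reg 3) Skip (Assign 2 (Const 0))"

text \<open>Row positions arise by repeated addition, as the machine cannot multiply; the last sum
  also yields the offset m * n to the labels.\<close>

definition index_rows :: com where
  "index_rows =
    Assign 27 (Const 4) ;;
    For 28 (Reg 2) (Store 2 (Reg 28) (Reg 27) ;; Assign 27 (Plus (Reg 27) (Reg 3))) ;;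
    Assign 6 (Minus (Reg 27) (Const 4))"

text \<open>Run twice by \<open>solver\<close>: first up to \<open>R\<close>, since
  \<open>count_bits\<close> needs 2 ^ R, then up to the number of bits found there.\<close>

definition powers :: "nat \<Rightarrow> com" where
  "powers c =
    Store 3 (Const 0) (Const 1) ;;
    For 28 (Reg c)
      (Store 3 (Plus (Reg 28) (Const 1)) (Plus (Elem 3 (Reg 28)) (Elem 3 (Reg 28))))"

definition count_bits :: com where
  "count_bits =
    Assign 27 (Minus (Plus (Elem 3 (Reg 4)) (Reg 5)) (Const 1)) ;;
    Assign 7 (Const 0) ;;
    For 28 (Plus (Reg 4) (Const 1)) (Assign 7 (Plus (Reg 7) (Reg 27)))"

definition front_loop :: com where
  "front_loop =
    For 11 (Reg 4) (
      Assign 12 (Plus (Reg 11) (Const 1)) ;;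
      Assign 13 (Reg 9) ;;
      search ;;
      Cond (Minus (Reg 9) (Reg 13))
        (Store 7 (Reg 10) (Reg 12) ;;
         Store 7 (Plus (Reg 10) (Const 1)) (Reg 13) ;;
         Assign 10 (Plus (Reg 10) (Const 2)) ;;
         Assign 9 (Reg 13))
        Skip)"

text \<open>The front is collected in array 7 because array 0 holds the input until the search has
  ended.\<close>

definition write_output :: com where
  "write_output =
    For 11 (Reg 10) (Store 0 (Reg 11) (Elem 7 (Reg 11))) ;;
    Assign 0 (Reg 10)"

definition solver :: com where
  "solver =
    read_header ;; index_rows ;; powers 4 ;; count_bits ;; powers 7 ;;
    Assign 9 (Reg 5) ;; Assign 10 (Const 0) ;; front_loop ;; write_output"

lemma writes_main [simp]:
  "writes index_rows = {6, 27, 28}" "writes_arr index_rows = {2}"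
  "writes (powers c) = {28}" "writes_arr (powers c) = {3}"
  "writes count_bits = {7, 27, 28}" "writes_arr count_bits = {}"
  by (auto simp: index_rows_def powers_def count_bits_def)

abbreviation flat :: "(nat \<times> nat) list \<Rightarrow> nat list" where
  "flat ps \<equiv> concat (map (\<lambda>(r, k). [r, k]) ps)"

lemma wp_powers:
  assumes "fst s c = N" "N \<le> M" "c \<noteq> 28"
  shows "wp M (powers c) (\<lambda>s'. \<forall>i \<le> N. snd s' 3 i = 2 ^ i) s"
  unfolding powers_def
proof (intro wp_Seq wp_Store, rule wp_For[where n = N and
    I = "\<lambda>k s'. \<forall>i \<le> k. snd s' 3 i = 2 ^ i"], goal_cases)
  case (8 k s')
  then show ?case by (intro wp_Store) (auto simp: le_Suc_eq)
qed (use assms in auto)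

lemma wp_write_output:
  assumes "fst s 10 \<le> M"
  shows "wp M write_output (\<lambda>s'. result s' = map (snd s 7) [0..<fst s 10]) s"
  unfolding write_output_def
proof (rule wp_Seq, rule wp_For[where n = "fst s 10" and
    I = "\<lambda>k s'. \<forall>i < k. snd s' 0 i = snd s 7 i"], goal_cases)
  case (8 k s')
  have "snd s' 7 = snd s 7" using 8(3) by (auto simp: same_def)
  with 8 show ?case by (intro wp_Store) (auto simp: less_Suc_eq)
next
  case (9 s')
  have "fst s' 10 = fst s 10" using 9(2) by (auto simp: same_def)
  with 9 show ?case by (intro wp_Assign) (auto simp: result_def)
qed (use assms in auto)

section \<open>The front as the set of drops of the least cost\<close>

context gnrm
begin

definition front :: "nat \<Rightarrow> (nat \<times> nat) set" where
  "front k = {(r, c). 1 \<le> r \<and> r \<le> k \<and> c \<le> kmax \<and> attainable r c \<and>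
    (\<forall>r' c'. 1 \<le> r' \<longrightarrow> attainable r' c' \<longrightarrow> \<not> (r' < r \<and> c' \<le> c \<or> r' \<le> r \<and> c' < c))}"

text \<open>\<open>b\<close> is the least cost attainable with at most \<open>k\<close> roles, cut
  off at \<open>kmax + 1\<close>, which stands for no solution within the budget.\<close>

definition least_cost :: "nat \<Rightarrow> nat \<Rightarrow> bool" where
  "least_cost k b \<longleftrightarrow> b \<le> kmax + 1 \<and>
    (\<forall>r c. 1 \<le> r \<longrightarrow> r \<le> k \<longrightarrow> c < b \<longrightarrow> \<not> attainable r c) \<and>
    (b \<le> kmax \<longrightarrow> (\<exists>r. 1 \<le> r \<and> r \<le> k \<and> attainable r b))"

text \<open>A dominating pair has no more roles than the pair it dominates, so raising
  \<open>k\<close> adds only pairs with \<open>Suc k\<close> roles. Such a pair must have the least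
  cost for \<open>Suc k\<close>, and it is undominated iff this cost is strictly below
  \<open>b\<close>.\<close>

lemma front_step:
  assumes b: "least_cost k b"
    and c: "c \<le> b" "\<forall>c' < c. \<not> attainable (Suc k) c'" "c < b \<longrightarrow> attainable (Suc k) c"
  shows "least_cost (Suc k) c"
    and "front (Suc k) = (if c < b then insert (Suc k, c) (front k) else front k)"
proof -
  show "least_cost (Suc k) c"
    using b c unfolding least_cost_def
    by (cases "c < b") (auto simp: le_Suc_eq intro: order_trans[of _ "Suc 0"])
  have "(Suc k, c') \<in> front (Suc k) \<longleftrightarrow> c' = c \<and> c < b" for c'
  proof
    assume L: "(Suc k, c') \<in> front (Suc k)"
    then have c': "c' \<le> kmax" "attainable (Suc k) c'"
      and opt: "\<And>r d. 1 \<le> r \<Longrightarrow> attainable r d \<Longrightarrow> \<not> (r < Suc k \<and> d \<le> c' \<or> r \<le> Suc k \<and> d < c')"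
      by (auto simp: front_def)
    have "c' < b"
    proof (rule ccontr)
      assume "\<not> c' < b"
      then obtain r where "1 \<le> r" "r \<le> k" "attainable r b" using b c'(1) by (auto simp: least_cost_def)
      with opt[of r b] \<open>\<not> c' < b\<close> show False by simp
    qed
    moreover have "c \<le> c'" using c(2) c'(2) by (meson not_less)
    ultimately show "c' = c \<and> c < b" using opt[of "Suc k" c] c(3) by auto
  next
    assume R: "c' = c \<and> c < b"
    then have "c \<le> kmax" "attainable (Suc k) c" using b c(3) by (auto simp: least_cost_def)
    moreover have "\<not> (r < Suc k \<and> d \<le> c \<or> r \<le> Suc k \<and> d < c)"
      if "1 \<le> r" "attainable r d" for r d
    proof
      assume "r < Suc k \<and> d \<le> c \<or> r \<le> Suc k \<and> d < c"
      then consider "r \<le> k" "d < b" | "r = Suc k" "d < c" using R by linarith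
      then show False using that b c(2) by cases (auto simp: least_cost_def)
    qed
    ultimately show "(Suc k, c') \<in> front (Suc k)" using R unfolding front_def by simp
  qed
  moreover have "(r, c') \<in> front (Suc k) \<longleftrightarrow> (r, c') \<in> front k" if "r \<noteq> Suc k" for r c'
    using that unfolding front_def by auto
  moreover have "(Suc k, c') \<notin> front k" for c' by (simp add: front_def)
  ultimately have "x \<in> front (Suc k) \<longleftrightarrow> x \<in> (if c < b then insert (Suc k, c) (front k) else front k)" for x
    by (cases x, cases "fst x = Suc k") auto
  then show "front (Suc k) = (if c < b then insert (Suc k, c) (front k) else front k)" by blast
qed

end

context gnrm_run
begin

lemma wp_index_rows:
  assumes "fst s 2 = m" "fst s 3 = n"
  shows "wp M index_rows (\<lambda>s'. (\<forall>i<m. snd s' 2 i = 4 + i * n) \<and> fst s' 6 = m * n) s"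
  unfolding index_rows_def
proof (intro wp_Seq wp_Assign, rule wp_For[where n = m and
    I = "\<lambda>k s'. (\<forall>i<k. snd s' 2 i = 4 + i * n) \<and> fst s' 27 = 4 + k * n"], goal_cases)
  case (8 k s')
  have "fst s' 3 = n" using 8(3) assms by (auto simp: same_def)
  with 8 show ?case by (intro wp_intros) (auto simp: less_Suc_eq)
next
  case (9 s')
  then show ?case by (intro wp_Assign) simp
qed (use assms M in auto)

lemma wp_count_bits:
  assumes "fst s 4 = R" "fst s 5 = kmax + 1" "snd s 3 R = 2 ^ R"
  shows "wp M count_bits (\<lambda>s'. fst s' 7 = bits) s"
  unfolding count_bits_def
proof (intro wp_Seq wp_Assign, rule wp_For[where n = "R + 1" and
    I = "\<lambda>k s'. fst s' 7 = k * (2 ^ R + kmax)"], goal_cases)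
  case (8 k s')
  have "fst s' 27 = 2 ^ R + kmax" using 8(3) assms by (auto simp: same_def)
  with 8 show ?case by (intro wp_Assign) simp
qed (use assms M in \<open>auto simp: bits_def\<close>)

text \<open>By \<open>front_step\<close> a pair is appended exactly when the minimum drops. Its
  number of roles exceeds all earlier ones, so no pair is repeated.\<close>

lemma wp_front_loop:
  assumes "env s" "fst s 9 = kmax + 1" "fst s 10 = 0"
  shows "wp M front_loop (\<lambda>s'. \<exists>ps. distinct ps \<and> set ps = front R \<and>
    map (snd s' 7) [0..<fst s' 10] = flat ps \<and> fst s' 10 \<le> M) s"
  unfolding front_loop_def
proof (rule wp_For[where n = R and I = "\<lambda>k s'. least_cost k (fst s' 9) \<and> fst s' 10 \<le> 2 * k \<and>
    (\<exists>ps. distinct ps \<and> set ps = front k \<and> map (snd s' 7) [0..<fst s' 10] = flat ps)"], goal_cases)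
  case (8 k s')
  have env: "env s'" using assms(1) 8(3) by (rule env_same) auto
  from 8(4) obtain ps where ps: "distinct ps" "set ps = front k"
    "map (snd s' 7) [0..<fst s' 10] = flat ps" by blast
  let ?s1 = "((fst s')(12 := Suc k, 13 := fst s' 9), snd s')"
  have "env ?s1" using env by (simp add: env_def)
  moreover have "fst s' 9 \<le> kmax + 1" using 8(4) by (simp add: least_cost_def)
  ultimately have se: "wp M search (\<lambda>s2. fst s2 13 \<le> fst s' 9 \<and>
      (\<forall>c < fst s2 13. \<not> attainable (Suc k) c) \<and>
      (fst s2 13 < fst s' 9 \<longrightarrow> attainable (Suc k) (fst s2 13))) s1" if "s1 = ?s1" for s1
    using wp_search[of ?s1 "Suc k"] 8(1) that by simp
  show ?case
  proof (intro wp_Seq wp_Assign, rule wp_conseq[OF se], goal_cases)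
    case (2 s2)
    have fr: "fst s2 9 = fst s' 9" "fst s2 10 = fst s' 10" "fst s2 12 = Suc k" "snd s2 7 = snd s' 7"
      using 2(2) 8(2) by (auto simp: same_def)
    have b: "least_cost k (fst s' 9)" using 8(4) by blast
    note step = front_step[OF b, of "fst s2 13"]
    have step: "least_cost (Suc k) (fst s2 13)"
        "front (Suc k) = (if fst s2 13 < fst s' 9 then insert (Suc k, fst s2 13) (front k) else front k)"
      using step 2(1) by blast+
    show ?case
    proof (rule wp_Cond, goal_cases)
      case 1
      then have lt: "fst s2 13 < fst s' 9" by (simp add: fr)
      have "distinct (ps @ [(Suc k, fst s2 13)])" using ps(1,2) by (auto simp: front_def)
      moreover have "set (ps @ [(Suc k, fst s2 13)]) = front (Suc k)" using ps(2) step(2) lt by simp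
      moreover have "map ((snd s' 7)(fst s' 10 := Suc k, Suc (fst s' 10) := fst s2 13))
          [0..<fst s' 10 + 2] = flat (ps @ [(Suc k, fst s2 13)])"
        using ps(3) by simp
      ultimately have "\<exists>ps. distinct ps \<and> set ps = front (Suc k) \<and>
          map ((snd s' 7)(fst s' 10 := Suc k, Suc (fst s' 10) := fst s2 13)) [0..<fst s' 10 + 2] = flat ps"
        by blast
      then show ?case using step(1) 8(4) fr by (intro wp_intros) simp
    next
      case 2
      then have "\<not> fst s2 13 < fst s' 9" by (simp add: fr)
      moreover from this have "fst s2 13 = fst s' 9" using \<open>fst s2 13 \<le> fst s' 9 \<and> _\<close> by simp
      ultimately show ?case using step ps fr 8(4) by (intro wp_Skip) auto
    qed
  qed (use 8(2) in simp)
next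
  case 7
  have "front 0 = {}" by (auto simp: front_def)
  then show ?case using assms by (auto simp: least_cost_def intro!: exI[of _ "[]"])
next
  case (9 s')
  then show ?case using M by auto
qed (use assms M in \<open>auto simp: env_regs\<close>)

lemma wp_solver:
  assumes dims: "(m, n) = (if m0 = 0 \<or> n0 = 0 then (0, 0) else (m0, n0))"
    and header: "snd s 0 0 = m0" "snd s 0 1 = n0" "snd s 0 2 = R" "snd s 0 3 = kmax"
    and entries: "\<And>i j. i < m \<Longrightarrow> j < n \<Longrightarrow> snd s 0 (4 + i * n + j) = of_bool (u i j)"
      "\<And>i j. i < m \<Longrightarrow> j < n \<Longrightarrow> snd s 0 (4 + i * n + j + m * n) = of_bool (f i j)"
  shows "wp M solver (\<lambda>s'. \<exists>ps. distinct ps \<and> set ps = front R \<and> result s' = flat ps) s"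
proof -
  have 1: "wp M read_header (\<lambda>s'. fst s' 2 = m \<and> fst s' 3 = n \<and> fst s' 4 = R \<and>
      fst s' 5 = kmax + 1 \<and> snd s' 0 = snd s 0) s"
    unfolding read_header_def
    by (intro wp_intros) (use dims header in \<open>auto split: if_splits\<close>)
  show ?thesis
    unfolding solver_def
  proof (rule wp_Seq, rule wp_conseq[OF 1], goal_cases)
    case (1 s1)
    then have s1: "fst s1 2 = m" "fst s1 3 = n" "fst s1 4 = R" "fst s1 5 = kmax + 1" "snd s1 0 = snd s 0"
      by auto
    show ?case
    proof (rule wp_Seq, rule wp_conseq[OF wp_index_rows[OF s1(1,2)]], goal_cases)
      case (1 s2)
      then have s2: "fst s2 2 = m" "fst s2 3 = n" "fst s2 4 = R" "fst s2 5 = kmax + 1" "fst s2 6 = m * n"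
          "snd s2 0 = snd s 0" "\<forall>i<m. snd s2 2 i = 4 + i * n"
        using s1 by (auto simp: same_def)
      have "R \<le> M" using M by simp
      show ?case
      proof (rule wp_Seq, rule wp_conseq[OF wp_powers[OF s2(3) \<open>R \<le> M\<close>]], simp, goal_cases)
        case (1 s3)
        then have s3: "fst s3 2 = m" "fst s3 3 = n" "fst s3 4 = R" "fst s3 5 = kmax + 1" "fst s3 6 = m * n"
            "snd s3 0 = snd s 0" "\<forall>i<m. snd s3 2 i = 4 + i * n" "snd s3 3 R = 2 ^ R"
          using s2 by (auto simp: same_def)
        show ?case
        proof (rule wp_Seq, rule wp_conseq[OF wp_count_bits[OF s3(3,4,8)]], goal_cases)
          case (1 s4)
          then have s4: "fst s4 2 = m" "fst s4 3 = n" "fst s4 4 = R" "fst s4 5 = kmax + 1"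
              "fst s4 6 = m * n" "snd s4 0 = snd s 0" "\<forall>i<m. snd s4 2 i = 4 + i * n" "fst s4 7 = bits"
            using s3 by (auto simp: same_def)
          show ?case
          proof (rule wp_Seq, rule wp_conseq[OF wp_powers[OF s4(8) M(4)]], simp, goal_cases)
            case (1 s5)
            have s5: "env s5" "fst s5 5 = kmax + 1"
              using 1 s4 entries by (auto simp: same_def env_def)
            show ?case
            proof (intro wp_Seq wp_Assign, rule wp_conseq[OF wp_front_loop], goal_cases)
              case (4 s6)
              then obtain ps where ps: "distinct ps" "set ps = front R"
                "map (snd s6 7) [0..<fst s6 10] = flat ps" "fst s6 10 \<le> M" by blast
              show ?case
                by (rule wp_conseq[OF wp_write_output[OF ps(4)]]) (use ps in auto)
            qed (use s5 in \<open>auto simp: env_def\<close>)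
          qed
        qed
      qed
    qed
  qed
qed

end


section \<open>Instances, their encoding, and the passage to the abstract problem\<close>

lemma enat_sum_le:
  assumes "\<And>x. x \<in> A \<Longrightarrow> g x = enat (h x) \<or> g x = \<infinity> \<and> c < h x" and "finite A"
  shows "sum g A \<le> enat c \<longleftrightarrow> sum h A \<le> c"
proof (cases "\<exists>x \<in> A. g x = \<infinity>")
  \<comment> \<open>One infinite summand makes the left sum infinite, and its finite substitute
    alone exceeds \<open>c\<close>.\<close>
  case True
  then obtain x where x: "x \<in> A" "g x = \<infinity>" by blast
  then have "c < h x" using assms(1)[OF x(1)] by auto
  also have "h x \<le> sum h A" using x(1) assms(2) by (intro member_le_sum) auto
  moreover have "sum g A = \<infinity>"
    using x sum.remove[OF assms(2) x(1), of g] by simp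
  ultimately show ?thesis by simp
next
  case False
  then have "g x = enat (h x)" if "x \<in> A" for x using assms(1)[OF that] that by auto
  then have "sum g A = (\<Sum>x\<in>A. enat (h x))" by (rule sum.cong[OF refl])
  also have "\<dots> = enat (sum h A)"
    using assms(2) by (induction A rule: finite_induct) (simp_all flip: zero_enat_def)
  finally show ?thesis by simp
qed

lemma nth_concat_rows:
  "i < m \<Longrightarrow> j < n \<Longrightarrow> concat (map (\<lambda>i. map (f i) [0..<n]) [0..<m]) ! (i * n + j) = f i j"
proof (induction m)
  case (Suc m)
  have len: "length (concat (map (\<lambda>i. map (f i) [0..<n]) [0..<m])) = m * n" for m
    by (induction m) auto
  have "i * n + j < m * n" if "i < m"
  proof -
    have "i * n + j < Suc i * n" using Suc.prems by simp
    also have "\<dots> \<le> m * n" using that by (intro mult_right_mono) auto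
    finally show ?thesis .
  qed
  with Suc show ?case by (auto simp: nth_append len less_Suc_eq)
qed simp

lemma nth_row_major:
  "i < dim_row A \<Longrightarrow> j < dim_col A \<Longrightarrow> row_major A ! (i * dim_col A + j) = A $$ (i, j)"
  unfolding row_major_def by (rule nth_concat_rows)

lemma length_row_major: "length (row_major A) = dim_row A * dim_col A"
  by (simp add: row_major_def length_concat comp_def sum_list_triv)

text \<open>An instance without entries has a very short encoding, so the loops over its rows and columns
  would be too long; such an instance is treated as one of dimension \<open>0 \<times> 0\<close>.\<close>

definition instance_rows :: "gnrm_instance \<Rightarrow> nat" where
  "instance_rows I = (if dim_col (UPA I) = 0 then 0 else dim_row (UPA I))"

definition instance_cols :: "gnrm_instance \<Rightarrow> nat" where
  "instance_cols I = (if dim_row (UPA I) = 0 then 0 else dim_col (UPA I))"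

definition exponent :: "gnrm_instance \<Rightarrow> nat" where
  "exponent I = rmax I * 2 ^ rmax I + rmax I * kmax I"

lemma encode_header:
  "encode BO_GNRM I ! 0 = dim_row (UPA I)" "encode BO_GNRM I ! Suc 0 = dim_col (UPA I)"
  "encode BO_GNRM I ! 2 = rmax I" "encode BO_GNRM I ! 3 = kmax I"
  by (simp_all add: BO_GNRM_def)

lemma length_encode:
  "I \<in> instances BO_GNRM \<Longrightarrow> length (encode BO_GNRM I) = 4 + 2 * (dim_row (UPA I) * dim_col (UPA I))"
  by (simp add: BO_GNRM_def length_row_major)

lemma encode_entries:
  assumes "I \<in> instances BO_GNRM" and i: "i < dim_row (UPA I)" and j: "j < dim_col (UPA I)"
  shows "encode BO_GNRM I ! (4 + i * dim_col (UPA I) + j) = of_bool (UPA I $$ (i, j))"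
    and "encode BO_GNRM I ! (4 + i * dim_col (UPA I) + j + dim_row (UPA I) * dim_col (UPA I)) =
      of_bool (lab I $$ (i, j) = LTop)"
    and "4 + i * dim_col (UPA I) + j + dim_row (UPA I) * dim_col (UPA I) < length (encode BO_GNRM I)"
proof -
  let ?m = "dim_row (UPA I)" and ?n = "dim_col (UPA I)"
  let ?k = "i * ?n + j"
  have dims: "dim_row (lab I) = ?m" "dim_col (lab I) = ?n" using assms(1) by (simp_all add: BO_GNRM_def)
  have "?k < Suc i * ?n" using j by simp
  also have "\<dots> \<le> ?m * ?n" using i by (intro mult_right_mono) auto
  finally have k: "?k < ?m * ?n" .
  have enc: "encode BO_GNRM I = [?m, ?n, rmax I, kmax I] @
      (map of_bool (row_major (UPA I)) @ map (\<lambda>f. of_bool (f = LTop)) (row_major (lab I)))"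
    by (simp add: BO_GNRM_def)
  have "4 + i * ?n + j = length [?m, ?n, rmax I, kmax I] + ?k" by simp
  then show "encode BO_GNRM I ! (4 + i * ?n + j) = of_bool (UPA I $$ (i, j))"
    unfolding enc nth_append_length_plus
    using k i j by (simp add: nth_append length_row_major nth_row_major)
  have idx: "4 + i * ?n + j + ?m * ?n =
      length [?m, ?n, rmax I, kmax I] + (length (map of_bool (row_major (UPA I)) :: nat list) + ?k)"
    by (simp add: length_row_major)
  show "encode BO_GNRM I ! (4 + i * ?n + j + ?m * ?n) = of_bool (lab I $$ (i, j) = LTop)"
    unfolding enc idx nth_append_length_plus
    using k i j nth_row_major[of i "lab I" j] dims by (simp add: length_row_major)
  show "4 + i * ?n + j + ?m * ?n < length (encode BO_GNRM I)"
    using k length_encode[OF assms(1)] by linarith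
qed

locale instance_run = fixes I :: gnrm_instance
  assumes I: "I \<in> instances BO_GNRM"
begin

sublocale gnrm "instance_rows I" "instance_cols I" "rmax I" "kmax I"
  "\<lambda>i j. UPA I $$ (i, j)" "\<lambda>i j. lab I $$ (i, j) = LTop" .

text \<open>As c \<le> kmax, an entry of infinite cost and one of weight \<open>kmax + 1\<close>
  both rule out a total of at most \<open>c\<close>; all other entries cost the same on both
  sides.\<close>

lemma feasible_iff:
  assumes "c \<le> kmax I"
  shows "feasible (UPA I) (lab I) r c \<longleftrightarrow> 1 \<le> r \<and> attainable r c"
proof -
  let ?m = "dim_row (UPA I)" and ?n = "dim_col (UPA I)"
  have sd_total: "sd (lab I) (UPA I) (bool_prod UA PA) \<le> enat c \<longleftrightarrow> total r ua pa \<le> c"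
    if UA: "UA \<in> carrier_mat ?m r" and PA: "PA \<in> carrier_mat r ?n"
      and ua: "\<And>i l. i < ?m \<Longrightarrow> l < r \<Longrightarrow> UA $$ (i, l) = ua i l"
      and pa: "\<And>l j. l < r \<Longrightarrow> j < ?n \<Longrightarrow> PA $$ (l, j) = pa l j" for UA PA ua pa
  proof -
    let ?x = "\<lambda>i j. \<exists>l<r. ua i l \<and> pa l j"
    have "sd (lab I) (UPA I) (bool_prod UA PA) =
        (\<Sum>(i, j)\<in>{..<?m} \<times> {..<?n}. sd_entry (lab I $$ (i, j)) (UPA I $$ (i, j)) (?x i j))"
      unfolding sd_def sum.cartesian_product
      by (intro sum.cong refl) (use UA PA in \<open>auto simp: bool_prod_def ua pa cong: conj_cong\<close>)
    \<comment> \<open>If one dimension is 0, both index sets are empty, so shrinking the instance to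
      0 x 0 keeps the sum.\<close>
    moreover have "total r ua pa = (\<Sum>(i, j)\<in>{..<?m} \<times> {..<?n}. weight i j (?x i j))"
      unfolding total_def sum.cartesian_product
      by (intro sum.cong refl) (auto simp: instance_rows_def instance_cols_def)
    moreover have "(\<Sum>(i, j)\<in>{..<?m} \<times> {..<?n}. sd_entry (lab I $$ (i, j)) (UPA I $$ (i, j)) (?x i j)) \<le> enat c
        \<longleftrightarrow> (\<Sum>(i, j)\<in>{..<?m} \<times> {..<?n}. weight i j (?x i j)) \<le> c"
    proof (rule enat_sum_le)
      fix p assume "p \<in> {..<?m} \<times> {..<?n}"
      obtain i j where p: "p = (i, j)" by (cases p)
      show "(case p of (i, j) \<Rightarrow> sd_entry (lab I $$ (i, j)) (UPA I $$ (i, j)) (?x i j)) =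
            enat (case p of (i, j) \<Rightarrow> weight i j (?x i j)) \<or>
          (case p of (i, j) \<Rightarrow> sd_entry (lab I $$ (i, j)) (UPA I $$ (i, j)) (?x i j)) = \<infinity> \<and>
            c < (case p of (i, j) \<Rightarrow> weight i j (?x i j))"
        using assms unfolding p prod.case weight_def sd_entry_def
        by (cases "lab I $$ (i, j)"; cases "UPA I $$ (i, j)"; cases "?x i j") simp_all
    qed simp
    ultimately show ?thesis by simp
  qed
  show ?thesis
  proof
    assume "feasible (UPA I) (lab I) r c"
    then obtain UA PA where "1 \<le> r" and m: "UA \<in> carrier_mat ?m r" "PA \<in> carrier_mat r ?n"
      and le: "sd (lab I) (UPA I) (bool_prod UA PA) \<le> enat c"
      unfolding feasible_def by blast
    moreover have "total r (\<lambda>i l. UA $$ (i, l)) (\<lambda>l j. PA $$ (l, j)) \<le> c"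
      using le by (subst (asm) sd_total[OF m]) (rule refl)+
    ultimately show "1 \<le> r \<and> attainable r c" unfolding attainable_def by blast
  next
    assume R: "1 \<le> r \<and> attainable r c"
    then obtain ua pa where t: "total r ua pa \<le> c" unfolding attainable_def by blast
    let ?UA = "mat ?m r (\<lambda>(i, l). ua i l)" and ?PA = "mat r ?n (\<lambda>(l, j). pa l j)"
    have "sd (lab I) (UPA I) (bool_prod ?UA ?PA) \<le> enat c"
      by (subst sd_total[of ?UA ?PA ua pa]) (use t in auto)
    then show "feasible (UPA I) (lab I) r c"
      using R unfolding feasible_def by (meson mat_carrier)
  qed
qed

lemma pareto_front_eq: "pareto_front I = front (rmax I)"
proof -
  have "(r, c) \<in> pareto_front I \<longleftrightarrow> (r, c) \<in> front (rmax I)" for r c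
  proof (cases "c \<le> kmax I")
    case True
    \<comment> \<open>A dominating pair has cost at most c \<le> kmax, so
      \<open>feasible_iff\<close> applies to it as well.\<close>
    have "(\<exists>r' k'. feasible (UPA I) (lab I) r' k' \<and> (r' < r \<and> k' \<le> c \<or> r' \<le> r \<and> k' < c)) \<longleftrightarrow>
        (\<exists>r' k'. (1 \<le> r' \<and> attainable r' k') \<and> (r' < r \<and> k' \<le> c \<or> r' \<le> r \<and> k' < c))"
      using feasible_iff True by (meson le_trans less_imp_le)
    with True show ?thesis
      by (simp add: pareto_front_def front_def pareto_optimal_def feasible_iff[OF True]) blast
  qed (simp add: pareto_front_def front_def)
  then show ?thesis by auto
qed

lemma bits_le: "bits \<le> 2 * exponent I"
proof -
  have "rmax I + 1 \<le> 2 * rmax I" using I by (simp add: BO_GNRM_def)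
  then have "bits \<le> 2 * rmax I * (2 ^ rmax I + kmax I)"
    unfolding bits_def by (rule mult_right_mono) simp
  then show ?thesis by (simp add: exponent_def algebra_simps)
qed

text \<open>Either both dimensions count as 0, or each is at most their product, hence at most the
  number of words; every word adds at least 1 to the size.\<close>

lemma size_bound: "instance_rows I + instance_cols I + 1 \<le> input_size BO_GNRM I"
proof -
  let ?m = "dim_row (UPA I)" and ?n = "dim_col (UPA I)"
  have "length xs \<le> (\<Sum>w\<leftarrow>xs. 1 + floorlog 2 w)" for xs by (induction xs) auto
  then have "4 + 2 * (?m * ?n) \<le> input_size BO_GNRM I"
    using length_encode[OF I] unfolding input_size_def by metis
  moreover have "instance_rows I \<le> ?m * ?n" "instance_cols I \<le> ?m * ?n"
    by (cases "?m"; cases "?n"; simp add: instance_rows_def instance_cols_def)+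
  ultimately show ?thesis by simp
qed

text \<open>The power of two bounds the number of bit strings by \<open>bits_le\<close>, and the
  input size bounds the dimensions, so their product bounds every loop.\<close>

lemma solver_correct:
  obtains t out where "computes solver (encode BO_GNRM I) t out" and "solution BO_GNRM I out"
    and "t \<le> time_bound (2 ^ (2 * exponent I) * input_size BO_GNRM I) solver"
proof -
  let ?M = "2 ^ (2 * exponent I) * input_size BO_GNRM I"
  have s: "1 \<le> input_size BO_GNRM I" "instance_rows I \<le> input_size BO_GNRM I"
    "instance_cols I \<le> input_size BO_GNRM I"
    using size_bound by auto
  have "(2::nat) ^ bits \<le> 2 ^ (2 * exponent I)" using bits_le by (rule power_increasing) simp
  then have b: "2 ^ bits \<le> ?M" using s(1) by (metis le_trans mult_le_mono mult.right_neutral)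
  have sM: "input_size BO_GNRM I \<le> ?M" by simp
  have r: "1 \<le> rmax I" using I by (simp add: BO_GNRM_def)
  \<comment> \<open>Since rmax \<ge> 1, the number of chunks is at least 2, which makes room for the
    output bound 2 * rmax + 1.\<close>
  have "2 * (rmax I + 1) \<le> (2 ^ rmax I + kmax I) * (rmax I + 1)"
    by (rule mult_right_mono) (use power_increasing[OF r, of "2::nat"] in auto)
  then have "2 * rmax I + 1 \<le> bits" unfolding bits_def by (simp add: algebra_simps)
  moreover have "bits < 2 ^ bits" by (rule less_exp)
  ultimately interpret gnrm_run "instance_rows I" "instance_cols I" "rmax I" "kmax I"
    "\<lambda>i j. UPA I $$ (i, j)" "\<lambda>i j. lab I $$ (i, j) = LTop" ?M
    using b s sM by unfold_locales linarith+
  let ?s = "input_state (encode BO_GNRM I)"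
  have nth: "snd ?s 0 i = encode BO_GNRM I ! i" if "i < length (encode BO_GNRM I)" for i
    using that by (simp add: input_state_def)
  have "wp ?M solver (\<lambda>s'. \<exists>ps. distinct ps \<and> set ps = front (rmax I) \<and> result s' = flat ps) ?s"
  proof (rule wp_solver[of "dim_row (UPA I)" "dim_col (UPA I)"], goal_cases)
    case (6 i j)
    then have "i < dim_row (UPA I)" "j < dim_col (UPA I)" "instance_cols I = dim_col (UPA I)"
      by (auto simp: instance_rows_def instance_cols_def split: if_splits)
    then show ?case using encode_entries[OF I, of i j] by (subst nth) simp_all
  next
    case (7 i j)
    then have "i < dim_row (UPA I)" "j < dim_col (UPA I)"
        "instance_rows I = dim_row (UPA I)" "instance_cols I = dim_col (UPA I)"
      by (auto simp: instance_rows_def instance_cols_def split: if_splits)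
    then show ?case using encode_entries[OF I, of i j] by (subst nth) simp_all
  qed (auto simp: nth encode_header length_encode[OF I] instance_rows_def instance_cols_def)
  then show ?thesis
    using that unfolding wp_def computes_def pareto_front_eq[symmetric]
    by (fastforce simp: BO_GNRM_def)
qed

end

section \<open>The parameterised running time\<close>

lemma computable_double_exponential: "computable (\<lambda>n. 2 ^ (B * 4 ^ n))"
  unfolding computable_def
proof (rule exI, rule allI)
  \<comment> \<open>Additions suffice: the first loop quadruples \<open>B\<close> n times, and the
    second doubles 1 as often as the first result says.\<close>
  let ?p = "Assign 2 (Const B) ;;
    For 3 (Elem 0 (Const 0)) (Assign 2 (Plus (Plus (Reg 2) (Reg 2)) (Plus (Reg 2) (Reg 2)))) ;;
    Assign 4 (Const 1) ;;
    For 3 (Reg 2) (Assign 4 (Plus (Reg 4) (Reg 4))) ;;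
    Store 0 (Const 0) (Reg 4)"
  fix n
  let ?M = "n + B * 4 ^ n"
  have "wp ?M ?p (\<lambda>s'. result s' = [2 ^ (B * 4 ^ n)]) (input_state [n])"
  proof (intro wp_Seq wp_Assign, rule wp_For[where n = n and
      I = "\<lambda>k s'. fst s' 2 = B * 4 ^ k"], goal_cases)
    case (9 s')
    have r0: "fst s' 0 = 1" using 9(2) by (auto simp: same_def input_state_def)
    show ?case
    proof (intro wp_Seq wp_Assign, rule wp_For[where n = "B * 4 ^ n" and
        I = "\<lambda>k s'. fst s' 4 = 2 ^ k"], goal_cases)
      case (9 s2)
      have "fst s2 0 = 1" using 9(2) r0 by (auto simp: same_def)
      then show ?case using 9(3) by (intro wp_Store) (simp add: result_def)
    qed (use 9(3) in \<open>auto intro!: wp_Assign\<close>)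
  qed (auto intro!: wp_Assign simp: input_state_def)
  then show "\<exists>t. computes ?p [n] t [2 ^ (B * 4 ^ n)]"
    unfolding wp_def computes_def by blast
qed

text \<open>Bounds the exponent by a function of the parameter alone: by n \<le> 2 ^ n, each of its
  two summands is at most 4 ^ (rmax + kmax).\<close>

lemma exponent_le: "exponent I \<le> 2 * 4 ^ (rmax I + kmax I)"
proof -
  have four: "(4::nat) ^ n = 2 ^ n * 2 ^ n" for n by (simp flip: power_mult_distrib)
  have lt: "n \<le> 2 ^ n" for n :: nat by (simp add: less_imp_le)
  have "rmax I * 2 ^ rmax I \<le> 4 ^ (rmax I)" unfolding four by (rule mult_right_mono[OF lt]) simp
  also have "\<dots> \<le> 4 ^ (rmax I + kmax I)" by (intro power_increasing) auto
  finally have 1: "rmax I * 2 ^ rmax I \<le> 4 ^ (rmax I + kmax I)" .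
  have "rmax I * kmax I \<le> 2 ^ rmax I * 2 ^ kmax I" by (rule mult_mono[OF lt lt]) auto
  also have "\<dots> \<le> 4 ^ (rmax I + kmax I)" by (simp flip: power_add add: power_mono)
  finally show ?thesis using 1 by (simp add: exponent_def)
qed

theorem theorem2p8:
  shows "(\<exists>p T e.
      e \<in> O[principal (instances BO_GNRM)](\<lambda>I. real (rmax I * 2 ^ rmax I + rmax I * kmax I)) \<and>
      T \<in> O_star BO_GNRM (\<lambda>I. 2 powr e I) \<and>
      solves_in_time p BO_GNRM T) \<and>
    fixed_parameter_tractable BO_GNRM (\<lambda>I. rmax I + kmax I)"
proof -
  obtain C d where time: "\<And>M. time_bound M solver \<le> C * (M + 1) ^ d"
    using time_bound_polynomial by blast
  \<comment> \<open>This is C * (2 * M) ^ d for the loop bound M of \<open>solver_correct\<close>,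
    using M + 1 \<le> 2 * M.\<close>
  define T where "T = (\<lambda>I. real (C * 2 ^ d) * 2 ^ (2 * d * exponent I) * real (input_size BO_GNRM I) ^ d)"
  have solves: "solves_in_time solver BO_GNRM T"
    unfolding solves_in_time_def
  proof
    fix I assume I: "I \<in> instances BO_GNRM"
    then interpret instance_run I by unfold_locales
    let ?M = "2 ^ (2 * exponent I) * input_size BO_GNRM I"
    obtain t out where t: "computes solver (encode BO_GNRM I) t out" "solution BO_GNRM I out"
      "t \<le> time_bound ?M solver"
      by (rule solver_correct)
    have "1 \<le> ?M" using size_bound by simp
    then have "(?M + 1) ^ d \<le> (2 * ?M) ^ d" by (intro power_mono) auto
    then have "t \<le> C * (2 * ?M) ^ d" using t(3) time[of ?M] by (meson le_trans mult_le_mono2)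
    then have "real t \<le> real (C * (2 * ?M) ^ d)" by (rule of_nat_mono)
    also have "\<dots> = T I"
      by (simp add: T_def power_mult_distrib power_mult[symmetric] mult_ac)
    finally show "\<exists>t out. computes solver (encode BO_GNRM I) t out \<and> solution BO_GNRM I out \<and> real t \<le> T I"
      using t by blast
  qed
  \<comment> \<open>One running time \<open>T\<close> serves both claims, with different bounds
    \<open>g\<close> on its exponential factor.\<close>
  have T_O_star: "T \<in> O_star BO_GNRM g"
    if "\<And>I. 2 ^ (2 * d * exponent I) \<le> g I" for g
    unfolding O_star_def
  proof (intro CollectI exI bigoI)
    show "\<forall>\<^sub>F I in principal (instances BO_GNRM).
        norm (T I) \<le> real (C * 2 ^ d) * norm (g I * real (input_size BO_GNRM I) ^ d)"
    proof (intro always_eventually allI)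
      fix I
      have g: "0 \<le> g I" using that[of I] by (rule order_trans[rotated]) simp
      have "T I \<le> real (C * 2 ^ d) * g I * real (input_size BO_GNRM I) ^ d"
        unfolding T_def using that by (intro mult_right_mono mult_left_mono) auto
      then show "norm (T I) \<le> real (C * 2 ^ d) * norm (g I * real (input_size BO_GNRM I) ^ d)"
        using g by (simp add: T_def abs_mult mult.assoc)
    qed
  qed
  define e where "e = (\<lambda>I. real (2 * d * exponent I))"
  have "e \<in> O[principal (instances BO_GNRM)](\<lambda>I. real (rmax I * 2 ^ rmax I + rmax I * kmax I))"
    by (rule bigoI[of _ "real (2 * d)"]) (simp add: e_def exponent_def)
  moreover have "T \<in> O_star BO_GNRM (\<lambda>I. 2 powr e I)"
    by (rule T_O_star) (simp add: e_def powr_realpow del: of_nat_mult)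
  moreover have "fixed_parameter_tractable BO_GNRM (\<lambda>I. rmax I + kmax I)"
    unfolding fixed_parameter_tractable_def
  proof (intro exI conjI)
    \<comment> \<open>The 4 is the 2 of \<open>exponent_le\<close> times the 2 in the exponent of
      \<open>T\<close>.\<close>
    show "computable (\<lambda>n. 2 ^ (4 * d * 4 ^ n))" by (rule computable_double_exponential)
    show "T \<in> O_star BO_GNRM (\<lambda>I. real (2 ^ (4 * d * 4 ^ (rmax I + kmax I))))"
    proof (rule T_O_star)
      fix I
      have "2 * d * exponent I \<le> 4 * d * 4 ^ (rmax I + kmax I)"
        using mult_left_mono[OF exponent_le[of I], of "2 * d"] by simp
      then show "2 ^ (2 * d * exponent I) \<le> real (2 ^ (4 * d * 4 ^ (rmax I + kmax I)))"
        by (simp add: power_increasing)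
    qed
    show "solves_in_time solver BO_GNRM T" by (rule solves)
  qed
  ultimately show ?thesis using solves by blast
qed

end
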